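(* Let $\kappa>0$, $d\ge1$, $\Omega=\mathbb T^d$, $\tau>0$, and let $(u^n)_{n\ge0}$ be real-valued functions on $\Omega$ generated from $u^0\in H^1(\Omega)$ by the first-order implicit-explicit scheme $$\frac{u^{n+1}-u^n}{\tau}=\kappa^2\Delta u^{n+1}+\sin(u^n),\qquad n\ge0.$$ If $0<\tau\le2$, then $$E(u^{n+1})\le E(u^n),\qquad\forall\,n\ge0,$$ where $$E(u^n)=\frac{\kappa^2}{2}\|\nabla u^n\|^2+\int_\Omega\cos(u^n)\,dx.$$
   Context: $\mathbb T^d=[-\pi,\pi]^d$ is the torus (periodic boundary conditions), and $\|\cdot\|=\|\cdot\|_{2}$ is the $L^2(\Omega)$ norm. The scheme is discrete in time only (step size $\tau$) and continuous in space; given $u^n$, the function $u^{n+1}$ is the unique periodic solution of the linear elliptic equation above. *)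

theory Defs
  imports "HOL-Analysis.Analysis"
begin

text \<open>Functions on the torus are represented by functions on \<open>real ^ 'd\<close> that are
  \<open>2 * pi\<close>-periodic in each coordinate; integrals are taken over the cell below with respect to
  Lebesgue measure.\<close>

definition torus_cell :: "(real ^ 'd) set"
  where "torus_cell = cbox (\<chi> i. - pi) (\<chi> i. pi)"

definition torus_measure :: "(real ^ 'd) measure"
  where "torus_measure = lebesgue_on torus_cell"

definition periodic :: "(real ^ 'd \<Rightarrow> 'b) \<Rightarrow> bool"
  where "periodic f \<longleftrightarrow> (\<forall>x i. f (x + axis i (2 * pi)) = f x)"

definition torus_L2 :: "(real ^ 'd \<Rightarrow> 'b::euclidean_space) \<Rightarrow> bool"
  where "torus_L2 f \<longleftrightarrow> periodic f \<and> f \<in> borel_measurable torus_measure \<and>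
    integrable torus_measure (\<lambda>x. (norm (f x))\<^sup>2)"

definition L2_torus_norm :: "(real ^ 'd \<Rightarrow> 'b::euclidean_space) \<Rightarrow> real"
  where "L2_torus_norm f = sqrt (\<integral>x. (norm (f x))\<^sup>2 \<partial>torus_measure)"

definition partial :: "'d \<Rightarrow> (real ^ 'd \<Rightarrow> real) \<Rightarrow> real ^ 'd \<Rightarrow> real"
  where "partial i f x = frechet_derivative f (at x) (axis i 1)"

definition laplacian :: "(real ^ 'd \<Rightarrow> real) \<Rightarrow> real ^ 'd \<Rightarrow> real"
  where "laplacian f x = (\<Sum>i\<in>UNIV. partial i (partial i f) x)"

primrec C_k :: "nat \<Rightarrow> (real ^ 'd \<Rightarrow> real) \<Rightarrow> bool"
  where
    "C_k 0 f \<longleftrightarrow> continuous_on UNIV f"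
  | "C_k (Suc k) f \<longleftrightarrow> f differentiable_on UNIV \<and> (\<forall>i. C_k k (partial i f))"

text \<open>On the torus, test functions need no support condition.\<close>

definition test_function :: "(real ^ 'd \<Rightarrow> real) \<Rightarrow> bool"
  where "test_function \<phi> \<longleftrightarrow> periodic \<phi> \<and> (\<forall>k. C_k k \<phi>)"

definition is_weak_gradient :: "(real ^ 'd \<Rightarrow> real) \<Rightarrow> (real ^ 'd \<Rightarrow> real ^ 'd) \<Rightarrow> bool"
  where "is_weak_gradient u G \<longleftrightarrow> (\<forall>\<phi> i. test_function \<phi> \<longrightarrow>
    (\<integral>x. u x * partial i \<phi> x \<partial>torus_measure) = - (\<integral>x. G x $ i * \<phi> x \<partial>torus_measure))"

definition is_weak_laplacian :: "(real ^ 'd \<Rightarrow> real) \<Rightarrow> (real ^ 'd \<Rightarrow> real) \<Rightarrow> bool"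
  where "is_weak_laplacian u g \<longleftrightarrow> (\<forall>\<phi>. test_function \<phi> \<longrightarrow>
    (\<integral>x. u x * laplacian \<phi> x \<partial>torus_measure) = (\<integral>x. g x * \<phi> x \<partial>torus_measure))"

definition torus_H1 :: "(real ^ 'd \<Rightarrow> real) \<Rightarrow> bool"
  where "torus_H1 u \<longleftrightarrow> torus_L2 u \<and> (\<exists>G. torus_L2 G \<and> is_weak_gradient u G)"

text \<open>For \<open>u\<close> in \<open>H\<^sup>1\<close> the weak gradient is determined up to a null set, so the choice is
  immaterial under integrals.\<close>

definition weak_gradient :: "(real ^ 'd \<Rightarrow> real) \<Rightarrow> real ^ 'd \<Rightarrow> real ^ 'd"
  where "weak_gradient u = (SOME G. torus_L2 G \<and> is_weak_gradient u G)"

text \<open>\<open>w\<close> is a solution in \<open>H\<^sup>1\<close> of the linear elliptic equation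
  \<open>(w - u) / \<tau> = \<kappa>\<^sup>2 \<Delta> w + sin u\<close>. The Laplacian is the distributional one; that it is
  (represented by) an \<open>L\<^sup>2\<close> function \<open>g\<close> is no restriction, since the equation forces it
  when \<open>u\<close> and \<open>w\<close> are in \<open>L\<^sup>2\<close>.\<close>

definition imex_step :: "real \<Rightarrow> real \<Rightarrow> (real ^ 'd \<Rightarrow> real) \<Rightarrow> (real ^ 'd \<Rightarrow> real) \<Rightarrow> bool"
  where "imex_step \<kappa> \<tau> u w \<longleftrightarrow> torus_H1 w \<and>
    (\<exists>g. torus_L2 g \<and> is_weak_laplacian w g \<and>
      (AE x in torus_measure. (w x - u x) / \<tau> = \<kappa>\<^sup>2 * g x + sin (u x)))"

definition energy :: "real \<Rightarrow> (real ^ 'd \<Rightarrow> real) \<Rightarrow> real"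
  where "energy \<kappa> u = \<kappa>\<^sup>2 / 2 * (L2_torus_norm (weak_gradient u))\<^sup>2
    + (\<integral>x. cos (u x) \<partial>torus_measure)"

end

theory Submission
  imports Defs
begin

text \<open>Let \<open>u\<close> and \<open>w\<close> be two consecutive iterates. Multiplying the scheme by the increment \<open>w - u\<close> and
integrating gives, with \<open>g\<close> the Laplacian of \<open>w\<close>,
\<open>\<parallel>w - u\<parallel>\<^sup>2 / \<tau> = \<kappa>\<^sup>2 * \<integral> g * (w - u) + \<integral> sin u * (w - u)\<close>.
By Green's identity the first integral on the right is minus the inner product of \<open>\<nabla>w\<close> with
\<open>\<nabla>w - \<nabla>u\<close>, hence at most \<open>\<parallel>\<nabla>u\<parallel>\<^sup>2 / 2 - \<parallel>\<nabla>w\<parallel>\<^sup>2 / 2\<close>. The second derivative of the cosine is at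
most one, so \<open>cos w \<le> cos u - sin u * (w - u) + (w - u)\<^sup>2 / 2\<close>. Adding up, the energy increases by
at most \<open>(1 / 2 - 1 / \<tau>) * \<parallel>w - u\<parallel>\<^sup>2\<close>, which is not positive for \<open>\<tau> \<le> 2\<close>. This is
\<open>imex_step_energy_le\<close>.

The analytic content lies in Green's identity \<open>weak_Green_identity\<close>: the weak derivatives are
defined by smooth test functions, whereas \<open>w - u\<close> is only in \<open>H\<^sup>1\<close>. The gap is closed by
mollification with trigonometric kernels. For a kernel \<open>K\<close> that is a finite combination of
characters \<open>cos (k \<bullet> z)\<close>, replacing each inner product of \<open>f\<close> and \<open>h\<close> by the integral of
\<open>f x * h y * K (x - y)\<close> turns Green's identity into an algebraic identity between Fourier
coefficients (\<open>kernel_form_Green\<close>). The inner products are recovered in the limit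
(\<open>kernel_form_tendsto\<close>) along the normalised powers of \<open>\<Sum>i. 1 + cos (z $ i)\<close>, which form an
approximate identity (\<open>approximate_identity_exists\<close>). The convergence follows from the density of
continuous functions in \<open>L\<^sup>2\<close> and a compactness estimate for continuous functions
(\<open>continuous_dense_L2\<close>, \<open>continuous_diff_le_torus_dist\<close>).\<close>

section \<open>Square-integrable functions\<close>

definition square_integrable :: "'a measure \<Rightarrow> ('a \<Rightarrow> real) \<Rightarrow> bool"
  where "square_integrable M f \<longleftrightarrow> f \<in> borel_measurable M \<and> integrable M (\<lambda>x. (f x)\<^sup>2)"

lemma abs_mult_le_sum_squares: "\<bar>a * b\<bar> \<le> (a\<^sup>2 + b\<^sup>2) / 2" for a b :: real
  using sum_squares_bound[of "\<bar>a\<bar>" "\<bar>b\<bar>"] by (simp add: abs_mult)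

lemma square_integrable_mult:
  assumes "square_integrable M f" "square_integrable M h"
  shows "integrable M (\<lambda>x. f x * h x)"
proof (rule Bochner_Integration.integrable_bound)
  show "integrable M (\<lambda>x. ((f x)\<^sup>2 + (h x)\<^sup>2) / 2)"
    using assms by (auto simp: square_integrable_def)
  show "(\<lambda>x. f x * h x) \<in> borel_measurable M"
    using assms by (auto simp: square_integrable_def)
  show "AE x in M. norm (f x * h x) \<le> norm (((f x)\<^sup>2 + (h x)\<^sup>2) / 2)"
  proof (intro AE_I2)
    fix x show "norm (f x * h x) \<le> norm (((f x)\<^sup>2 + (h x)\<^sup>2) / 2)"
      using abs_mult_le_sum_squares[of "f x" "h x"] by simp
  qed
qed

lemma square_integrable_add:
  assumes "square_integrable M f" "square_integrable M h"
  shows "square_integrable M (\<lambda>x. f x + h x)"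
  using assms square_integrable_mult[OF assms] unfolding square_integrable_def
  by (auto simp: power2_sum mult.assoc)

lemma square_integrable_cmult:
  assumes "square_integrable M f"
  shows "square_integrable M (\<lambda>x. c * f x)"
  using assms unfolding square_integrable_def by (auto simp: power_mult_distrib)

lemma square_integrable_diff:
  assumes "square_integrable M f" "square_integrable M h"
  shows "square_integrable M (\<lambda>x. f x - h x)"
  using square_integrable_add[OF assms(1) square_integrable_cmult[OF assms(2), of "-1"]] by simp

lemma square_integrable_bounded:
  assumes "finite_measure M" "f \<in> borel_measurable M" "\<And>x. x \<in> space M \<Longrightarrow> \<bar>f x\<bar> \<le> C"
  shows "square_integrable M f"
  unfolding square_integrable_def
proof
  have "norm ((f x)\<^sup>2) \<le> C\<^sup>2" if "x \<in> space M" for x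
    using power_mono[OF assms(3)[OF that], of 2] by simp
  then have "AE x in M. norm ((f x)\<^sup>2) \<le> C\<^sup>2"
    by (rule AE_I2)
  then show "integrable M (\<lambda>x. (f x)\<^sup>2)"
    by (rule finite_measure.integrable_const_bound[OF assms(1)])
      (rule borel_measurable_power[OF assms(2)])
qed fact

lemma square_integrable_imp_integrable:
  assumes "finite_measure M" "square_integrable M f"
  shows "integrable M f"
  using square_integrable_mult[OF assms(2) square_integrable_bounded[OF assms(1), of "\<lambda>_. 1" 1]] by simp

context
  fixes M :: "'a measure" and N :: "'b measure" and f :: "'a \<Rightarrow> real" and h :: "'b \<Rightarrow> real"
  assumes M: "sigma_finite_measure M" and N: "sigma_finite_measure N"
    and f: "integrable M f" and h: "integrable N h"
begin

lemma integrable_pair_mult: "integrable (M \<Otimes>\<^sub>M N) (\<lambda>z. f (fst z) * h (snd z))"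
proof -
  interpret pair_sigma_finite M N
    using M N by (simp add: pair_sigma_finite_def)
  have [measurable]: "f \<in> borel_measurable M" "h \<in> borel_measurable N"
    using f h by auto
  show ?thesis
  proof (rule Fubini_integrable)
    show "integrable M (\<lambda>x. \<integral>y. norm (f (fst (x, y)) * h (snd (x, y))) \<partial>N)"
      using f by (simp add: abs_mult)
  qed (use h in auto)
qed

lemma integral_pair_mult:
  "(\<integral>z. f (fst z) * h (snd z) \<partial>(M \<Otimes>\<^sub>M N)) = (\<integral>x. f x \<partial>M) * (\<integral>y. h y \<partial>N)"
proof -
  interpret pair_sigma_finite M N
    using M N by (simp add: pair_sigma_finite_def)
  show ?thesis
    using integral_fst'[OF integrable_pair_mult] by simp
qed

end

section \<open>The measure space of the torus cell\<close>

lemma finite_measure_torus: "finite_measure (torus_measure :: (real ^ 'd) measure)"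
  unfolding torus_measure_def torus_cell_def by (intro finite_measure_lebesgue_on lmeasurable_cbox)

interpretation torus: finite_measure "torus_measure :: (real ^ 'd) measure"
  by (rule finite_measure_torus)

interpretation torus2: pair_sigma_finite "torus_measure :: (real ^ 'd) measure"
    "torus_measure :: (real ^ 'd) measure"
  by unfold_locales

lemma space_torus [simp]: "space torus_measure = torus_cell"
  by (simp add: torus_measure_def)

lemma sets_torus_cell: "torus_cell \<in> sets lebesgue"
  by (simp add: torus_cell_def)

lemma borel_measurable_torus:
  "f \<in> borel_measurable borel \<Longrightarrow> f \<in> borel_measurable torus_measure"
  unfolding torus_measure_def
  by (intro measurable_restrict_space1 measurable_completion) simp

lemma ident_measurable_torus [measurable]: "(\<lambda>x. x) \<in> measurable torus_measure borel"
  unfolding torus_measure_def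
  by (intro measurable_restrict_space1 measurable_completion) simp

lemma compact_torus_cell: "compact torus_cell"
  by (simp add: torus_cell_def)

lemma square_integrable_continuous:
  assumes "continuous_on UNIV f"
  shows "square_integrable torus_measure f"
proof -
  have "bounded (f ` torus_cell)"
    using compact_continuous_image[OF continuous_on_subset[OF assms] compact_torus_cell]
    by (auto intro: compact_imp_bounded)
  then obtain C where "\<And>x. x \<in> torus_cell \<Longrightarrow> \<bar>f x\<bar> \<le> C"
    by (auto simp: bounded_iff)
  then show ?thesis
    using borel_measurable_torus[OF borel_measurable_continuous_onI[OF assms]]
    by (intro square_integrable_bounded[OF finite_measure_torus, of _ C]) simp_all
qed

lemma integral_torus_measure_continuous:
  fixes f :: "real ^ 'd \<Rightarrow> real"
  assumes "continuous_on UNIV f"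
  shows "(\<integral>x. f x \<partial>torus_measure) = integral torus_cell f"
proof -
  have "integrable (lebesgue_on torus_cell) f"
    using square_integrable_imp_integrable[OF finite_measure_torus square_integrable_continuous[OF assms]]
    by (simp only: torus_measure_def)
  then show ?thesis
    unfolding torus_measure_def by (rule lebesgue_integral_eq_integral[OF _ sets_torus_cell])
qed

section \<open>Density of continuous functions\<close>

lemma truncation_tendsto_L2:
  assumes f: "square_integrable M f"
  shows "(\<lambda>n. \<integral>x. (f x - max (- real n) (min (real n) (f x)))\<^sup>2 \<partial>M) \<longlonglongrightarrow> 0"
proof -
  have [measurable]: "f \<in> borel_measurable M" and "integrable M (\<lambda>x. (f x)\<^sup>2)"
    using f by (auto simp: square_integrable_def)
  have "(\<lambda>n. \<integral>x. (f x - max (- real n) (min (real n) (f x)))\<^sup>2 \<partial>M) \<longlonglongrightarrow> (\<integral>x. 0 \<partial>M)"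
  proof (rule integral_dominated_convergence)
    show "integrable M (\<lambda>x. (f x)\<^sup>2)" by fact
    show "AE x in M. (\<lambda>n. (f x - max (- real n) (min (real n) (f x)))\<^sup>2) \<longlonglongrightarrow> 0"
    proof (intro AE_I2 tendsto_eventually)
      fix x
      obtain n0 where n0: "\<bar>f x\<bar> \<le> real n0" using real_arch_simple by blast
      show "\<forall>\<^sub>F n in sequentially. (f x - max (- real n) (min (real n) (f x)))\<^sup>2 = 0"
        using eventually_ge_at_top[of n0]
      proof eventually_elim
        case (elim n)
        then have "\<bar>f x\<bar> \<le> real n" using n0 by linarith
        then show ?case by (auto simp: max_def min_def)
      qed
    qed
    show "AE x in M. norm ((f x - max (- real n) (min (real n) (f x)))\<^sup>2) \<le> (f x)\<^sup>2" for n
    proof (intro AE_I2)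
      fix x
      have "\<bar>f x - max (- real n) (min (real n) (f x))\<bar> \<le> \<bar>f x\<bar>"
        by (auto simp: max_def min_def)
      then show "norm ((f x - max (- real n) (min (real n) (f x)))\<^sup>2) \<le> (f x)\<^sup>2"
        by (simp add: abs_le_square_iff)
    qed
  qed auto
  then show ?thesis by simp
qed

lemma interior_torus_cell: "interior torus_cell = box (\<chi> i. - pi) (\<chi> i. pi)"
  by (simp add: torus_cell_def interior_cbox)

lemma AE_torus_not_negligible:
  assumes "negligible N"
  shows "AE x in torus_measure. x \<notin> N"
proof -
  have "AE x in lebesgue. x \<notin> N"
    using assms by (intro AE_not_in) (simp add: negligible_iff_null_sets)
  then show ?thesis
    unfolding torus_measure_def by (subst AE_restrict_space_iff) (auto simp: sets_torus_cell)
qed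

text \<open>Lebesgue measurability provides continuous functions converging almost everywhere. Clamping them
at the bound of \<open>f\<close> makes dominated convergence applicable. The cutoff by the distance to the
complement of the open cell costs only the null set on its frontier and makes the approximants
vanish there, so that they respect the identification of opposite faces.\<close>

lemma bounded_approx_continuous_L2:
  fixes f :: "real ^ 'd \<Rightarrow> real"
  assumes f: "f \<in> borel_measurable torus_measure" and C: "\<And>x. \<bar>f x\<bar> \<le> C"
  obtains p where "\<And>n. continuous_on UNIV (p n)" and "\<And>n x. x \<notin> interior torus_cell \<Longrightarrow> p n x = 0"
    and "(\<lambda>n. \<integral>x. (f x - p n x)\<^sup>2 \<partial>torus_measure) \<longlonglongrightarrow> 0"
proof -
  have "0 \<le> C" using C[of 0] by linarith
  have "f measurable_on torus_cell"
    using f unfolding torus_measure_def measurable_on_iff_borel_measurable[OF sets_torus_cell] .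
  then obtain N g where N: "negligible N" and g: "\<And>n. continuous_on UNIV (g n)"
    and lim: "\<And>x. x \<notin> N \<Longrightarrow> (\<lambda>n. g n x) \<longlonglongrightarrow> (if x \<in> torus_cell then f x else 0)"
    unfolding measurable_on_def by blast
  define S :: "(real ^ 'd) set" where "S = - interior torus_cell"
  have "(\<chi> i. - pi) \<in> S"
    by (auto simp: S_def interior_torus_cell mem_box_cart)
  then have S: "closed S" "S \<noteq> {}"
    by (auto simp: S_def)
  define p where "p n x = max (- C) (min C (g n x)) * min 1 (real n * infdist x S)" for n x
  have cont: "continuous_on UNIV (p n)" for n
    unfolding p_def by (intro continuous_intros g)
  have zero: "p n x = 0" if "x \<notin> interior torus_cell" for n x
    using that infdist_zero[of x S] by (simp add: p_def S_def)
  have bound: "\<bar>p n x\<bar> \<le> C" for n x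
  proof -
    have "\<bar>max (- C) (min C (g n x))\<bar> \<le> C" using \<open>0 \<le> C\<close> by (auto simp: max_def min_def)
    moreover have "\<bar>min 1 (real n * infdist x S)\<bar> \<le> 1"
      using infdist_nonneg[of x S] by (auto simp: min_def abs_mult)
    ultimately show ?thesis
      unfolding p_def abs_mult using mult_mono[of _ C _ 1] \<open>0 \<le> C\<close> by fastforce
  qed
  have "negligible (frontier torus_cell :: (real ^ 'd) set)"
    by (simp add: torus_cell_def negligible_convex_frontier)
  with N have neg: "negligible (N \<union> frontier torus_cell)"
    by (rule negligible_Un)
  have pm: "p n \<in> borel_measurable torus_measure" for n
    using borel_measurable_torus[OF borel_measurable_continuous_onI[OF cont]] .
  have "(\<lambda>n. \<integral>x. (f x - p n x)\<^sup>2 \<partial>torus_measure) \<longlonglongrightarrow> (\<integral>x. 0 \<partial>(torus_measure :: (real ^ 'd) measure))"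
  proof (rule integral_dominated_convergence)
    show "AE x in torus_measure. (\<lambda>n. (f x - p n x)\<^sup>2) \<longlonglongrightarrow> 0"
      using AE_torus_not_negligible[OF neg] AE_space
    proof eventually_elim
      case (elim x)
      then have x: "x \<in> torus_cell" "x \<notin> N" "x \<notin> S"
        by (auto simp: S_def frontier_def torus_cell_def)
      then have "(\<lambda>n. g n x) \<longlonglongrightarrow> f x" using lim[of x] by simp
      then have "(\<lambda>n. max (- C) (min C (g n x))) \<longlonglongrightarrow> max (- C) (min C (f x))"
        by (intro tendsto_intros)
      also have "max (- C) (min C (f x)) = f x" using C[of x] by (auto simp: max_def min_def)
      finally have 1: "(\<lambda>n. max (- C) (min C (g n x))) \<longlonglongrightarrow> f x" .
      have "infdist x S > 0"
        using x S infdist_nonneg[of x S] in_closed_iff_infdist_zero[of S x] by linarith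
      then obtain n0 where n0: "1 \<le> real n0 * infdist x S"
        by (metis ex_less_of_nat_mult less_imp_le)
      have "\<forall>\<^sub>F n in sequentially. min 1 (real n * infdist x S) = 1"
        using eventually_ge_at_top[of n0]
      proof eventually_elim
        case (elim n)
        then have "real n0 * infdist x S \<le> real n * infdist x S"
          by (intro mult_right_mono infdist_nonneg) simp
        with n0 show ?case by simp
      qed
      then have "(\<lambda>n. min 1 (real n * infdist x S)) \<longlonglongrightarrow> 1"
        by (rule tendsto_eventually)
      then have "(\<lambda>n. p n x) \<longlonglongrightarrow> f x * 1"
        unfolding p_def by (intro tendsto_mult 1)
      then have "(\<lambda>n. (f x - p n x)\<^sup>2) \<longlonglongrightarrow> (f x - f x * 1)\<^sup>2"
        by (intro tendsto_intros)
      then show ?case by simp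
    qed
    show "AE x in torus_measure. norm ((f x - p n x)\<^sup>2) \<le> (2 * C)\<^sup>2" for n
    proof (intro AE_I2)
      fix x
      have "\<bar>f x - p n x\<bar> \<le> \<bar>2 * C\<bar>" using C[of x] bound[of n x] by linarith
      then show "norm ((f x - p n x)\<^sup>2) \<le> (2 * C)\<^sup>2" by (simp add: abs_le_square_iff)
    qed
  qed (use f pm in \<open>simp_all add: torus.integrable_const\<close>)
  then show ?thesis
    using that[OF cont zero] by simp
qed

lemma continuous_dense_L2:
  fixes f :: "real ^ 'd \<Rightarrow> real"
  assumes f: "square_integrable torus_measure f" and "0 < e"
  obtains p where "continuous_on UNIV p" and "\<And>x. x \<notin> interior torus_cell \<Longrightarrow> p x = 0"
    and "(\<integral>x. (f x - p x)\<^sup>2 \<partial>torus_measure) < e"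
proof -
  obtain n where n: "(\<integral>x. (f x - max (- real n) (min (real n) (f x)))\<^sup>2 \<partial>torus_measure) < e / 4"
    using order_tendstoD(2)[OF truncation_tendsto_L2[OF f], of "e / 4"] \<open>0 < e\<close>
    by (auto simp: eventually_sequentially)
  define h where "h x = max (- real n) (min (real n) (f x))" for x
  have h: "h \<in> borel_measurable torus_measure" "\<bar>h x\<bar> \<le> real n" for x
    using f unfolding h_def square_integrable_def by auto
  obtain p where cont: "\<And>n. continuous_on UNIV (p n)"
    and zero: "\<And>n x. x \<notin> interior torus_cell \<Longrightarrow> p n x = 0"
    and lim: "(\<lambda>n. \<integral>x. (h x - p n x)\<^sup>2 \<partial>torus_measure) \<longlonglongrightarrow> 0"
    using bounded_approx_continuous_L2[OF h] by blast
  obtain m where m: "(\<integral>x. (h x - p m x)\<^sup>2 \<partial>torus_measure) < e / 4"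
    using order_tendstoD(2)[OF lim, of "e / 4"] \<open>0 < e\<close>
    by (auto simp: eventually_sequentially)
  have hs: "square_integrable torus_measure h"
    by (rule square_integrable_bounded[OF finite_measure_torus h])
  have i1: "integrable torus_measure (\<lambda>x. (f x - h x)\<^sup>2)"
    and i2: "integrable torus_measure (\<lambda>x. (h x - p m x)\<^sup>2)"
    and i3: "integrable torus_measure (\<lambda>x. (f x - p m x)\<^sup>2)"
    using square_integrable_diff[OF f hs] square_integrable_diff[OF hs square_integrable_continuous[OF cont]]
      square_integrable_diff[OF f square_integrable_continuous[OF cont]]
    by (auto simp: square_integrable_def)
  have "(f x - p m x)\<^sup>2 \<le> 2 * (f x - h x)\<^sup>2 + 2 * (h x - p m x)\<^sup>2" for x
    using sum_squares_bound[of "f x - h x" "h x - p m x"]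
    by (simp add: power2_eq_square algebra_simps)
  then have "(\<integral>x. (f x - p m x)\<^sup>2 \<partial>torus_measure)
      \<le> (\<integral>x. 2 * (f x - h x)\<^sup>2 + 2 * (h x - p m x)\<^sup>2 \<partial>torus_measure)"
    using i1 i2 i3 by (intro integral_mono) auto
  also have "\<dots> = 2 * (\<integral>x. (f x - h x)\<^sup>2 \<partial>torus_measure) + 2 * (\<integral>x. (h x - p m x)\<^sup>2 \<partial>torus_measure)"
    using i1 i2 by simp
  also have "\<dots> < e"
    using n m by (simp add: h_def)
  finally show ?thesis
    using that[OF cont zero] by blast
qed

section \<open>Trigonometric test functions\<close>

lemma cos_inner_has_derivative:
  "((\<lambda>x. a * cos (k \<bullet> x + s)) has_derivative (\<lambda>h. - a * sin (k \<bullet> x + s) * (k \<bullet> h))) (at x)"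
  by (auto intro!: derivative_eq_intros simp: algebra_simps)

lemma partial_cos:
  fixes k :: "real ^ 'd"
  shows "partial i (\<lambda>x. a * cos (k \<bullet> x + s))
    = (\<lambda>x. (a * (k $ i)) * cos (k \<bullet> x + (s + pi / 2)))"
proof
  fix x :: "real ^ 'd"
  have "frechet_derivative (\<lambda>x. a * cos (k \<bullet> x + s)) (at x)
      = (\<lambda>h. - a * sin (k \<bullet> x + s) * (k \<bullet> h))"
    by (rule frechet_derivative_at[symmetric, OF cos_inner_has_derivative])
  moreover have "cos (k \<bullet> x + (s + pi / 2)) = - sin (k \<bullet> x + s)"
    by (simp add: cos_add sin_add add.assoc[symmetric] del: add.assoc)
  ultimately show "partial i (\<lambda>x. a * cos (k \<bullet> x + s)) x
      = (a * (k $ i)) * cos (k \<bullet> x + (s + pi / 2))"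
    by (simp add: partial_def inner_axis)
qed

lemma C_k_cos: fixes k :: "real ^ 'd" shows "C_k n (\<lambda>x. a * cos (k \<bullet> x + s))"
proof (induction n arbitrary: a s)
  case 0
  show ?case by (auto intro!: continuous_intros)
next
  case (Suc n)
  have "(\<lambda>x. a * cos (k \<bullet> x + s)) differentiable_on UNIV"
    unfolding differentiable_on_def differentiable_def
    using has_derivative_at_withinI[OF cos_inner_has_derivative[of a k s]] by fast
  with Suc show ?case
    by (simp add: partial_cos)
qed

lemma cos_add_int_period:
  assumes "m \<in> \<int>"
  shows "cos (t + m * (2 * pi)) = cos t"
proof -
  obtain j where "m = of_int j" using assms by (auto elim: Ints_cases)
  then show ?thesis
    using cos.plus_of_int[of t j] by (simp add: mult_ac)
qed

lemma test_function_cos: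
  assumes "\<And>i. k $ i \<in> \<int>"
  shows "test_function (\<lambda>x. cos (k \<bullet> x + s))"
proof -
  have "C_k n (\<lambda>x. cos (k \<bullet> x + s))" for n
    using C_k_cos[of n 1 k s] by simp
  moreover have "cos (k \<bullet> (x + axis i (2 * pi)) + s) = cos (k \<bullet> x + s)" for x i
    using cos_add_int_period[OF assms, of "k \<bullet> x + s" i]
    by (simp add: inner_add_right inner_axis add_ac)
  ultimately show ?thesis
    by (simp add: test_function_def periodic_def)
qed

lemma laplacian_cos:
  "laplacian (\<lambda>x. cos (k \<bullet> x + s)) x = - (\<Sum>i\<in>UNIV. (k $ i)\<^sup>2) * cos (k \<bullet> x + s)"
proof -
  have "partial i (partial i (\<lambda>x. cos (k \<bullet> x + s))) x = - (k $ i)\<^sup>2 * cos (k \<bullet> x + s)" for i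
  proof -
    have "k \<bullet> x + (s + pi / 2 + pi / 2) = k \<bullet> x + s + pi"
      by linarith
    then have "cos (k \<bullet> x + (s + pi / 2 + pi / 2)) = - cos (k \<bullet> x + s)"
      by (simp only: cos_periodic_pi)
    moreover have "partial i (partial i (\<lambda>x. cos (k \<bullet> x + s)))
        = (\<lambda>x. k $ i * k $ i * cos (k \<bullet> x + (s + pi / 2 + pi / 2)))"
      using partial_cos[of i 1 k s] partial_cos[of i "k $ i" k "s + pi / 2"]
      by (simp only: mult_1)
    ultimately show ?thesis
      by (simp add: power2_eq_square)
  qed
  then show ?thesis
    by (simp add: laplacian_def sum_distrib_right sum_negf)
qed

text \<open>The slab that the shift pushes out of the cell on one side is a translate by a full period of the
slab that it uncovers on the other side.\<close>

lemma integral_torus_shift: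
  fixes f :: "real ^ 'd \<Rightarrow> real"
  assumes cont: "continuous_on UNIV f"
    and per: "\<And>x. f (x + axis i (2 * pi)) = f x"
    and a: "0 \<le> a" "a \<le> 2 * pi"
  shows "integral torus_cell (\<lambda>x. f (x + axis i a)) = integral torus_cell f"
proof -
  define A B :: "real ^ 'd" where "A = (\<chi> i. - pi)" and "B = (\<chi> i. pi)"
  define A' where "A' = (\<chi> j. if j = i then a - pi else - pi)"
  define B' where "B' = (\<chi> j. if j = i then a - pi else pi)"
  have mem_cell: "x \<in> cbox p q \<longleftrightarrow> p $ i \<le> x $ i \<and> x $ i \<le> q $ i \<and>
      (\<forall>j. j \<noteq> i \<longrightarrow> p $ j \<le> x $ j \<and> x $ j \<le> q $ j)" for x p q :: "real ^ 'd"
    unfolding mem_box_cart by metis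
  have inner_i: "x \<bullet> axis i 1 = x $ i" for x :: "real ^ 'd"
    by (simp add: inner_axis)
  have int: "f integrable_on cbox x y" for x y
    by (intro integrable_continuous continuous_on_subset[OF cont]) auto
  have shift: "integral (cbox x y) (\<lambda>x. f (x + c)) = integral (cbox (x + c) (y + c)) f" for x y c
    using integral_shift_cbox[of "x + c" c "y + c" f] by simp
  have "integral (cbox A B) f = integral (cbox A B') f + integral (cbox A' B) f"
  proof -
    have "cbox A B \<inter> {x. x \<bullet> axis i 1 \<le> a - pi} = cbox A B'"
      "cbox A B \<inter> {x. x \<bullet> axis i 1 \<ge> a - pi} = cbox A' B"
      using a unfolding set_eq_iff Int_iff mem_Collect_eq mem_cell inner_i
      by (auto simp: A_def B_def A'_def B'_def)
    then show ?thesis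
      using integral_split[of f A B "axis i 1" "a - pi"] int by (simp add: axis_in_Basis_iff)
  qed
  moreover have "integral (cbox A B') f = integral (cbox (A + axis i (2*pi)) (B' + axis i (2*pi))) f"
    using shift[of A B' "axis i (2*pi)"] per by simp
  moreover have "integral (cbox (A + axis i a) (B + axis i a)) f =
     integral (cbox A' B) f + integral (cbox (A + axis i (2*pi)) (B' + axis i (2*pi))) f"
  proof -
    have "cbox (A + axis i a) (B + axis i a) \<inter> {x. x \<bullet> axis i 1 \<le> pi} = cbox A' B"
      "cbox (A + axis i a) (B + axis i a) \<inter> {x. x \<bullet> axis i 1 \<ge> pi}
         = cbox (A + axis i (2*pi)) (B' + axis i (2*pi))"
      using a unfolding set_eq_iff Int_iff mem_Collect_eq mem_cell inner_i
      by (auto simp: A_def B_def A'_def B'_def axis_def)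
    then show ?thesis
      using integral_split[of f "A + axis i a" "B + axis i a" "axis i 1" "pi"] int
      by (simp add: axis_in_Basis_iff)
  qed
  ultimately show ?thesis
    using shift[of A B "axis i a"] by (simp add: torus_cell_def A_def B_def)
qed

lemma integral_torus_cos_eq_0:
  assumes k: "\<And>i. k $ i \<in> \<int>" and "k \<noteq> 0"
  shows "integral torus_cell (\<lambda>x. cos (k \<bullet> x + s)) = 0"
proof -
  obtain i where i: "k $ i \<noteq> 0" using \<open>k \<noteq> 0\<close> by (auto simp: vec_eq_iff)
  \<comment> \<open>The shift by half a wavelength in a direction with nonzero frequency reverses the sign.\<close>
  define a where "a = pi / \<bar>k $ i\<bar>"
  have "\<bar>k $ i\<bar> \<ge> 1" using i k[of i] by (simp add: Ints_nonzero_abs_ge1)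
  then have a: "0 \<le> a" "a \<le> 2 * pi"
    using pi_gt_zero mult_left_mono[of 1 "\<bar>k $ i\<bar>" "2*pi"]
    by (auto simp: a_def divide_simps simp del: pi_gt_zero) 
  have "cos (k \<bullet> (x + axis i a) + s) = - cos (k \<bullet> x + s)" for x
  proof -
    have "k $ i * a = pi \<or> k $ i * a = - pi"
      using i by (auto simp: a_def abs_if)
    moreover have "k \<bullet> (x + axis i a) + s = (k \<bullet> x + s) + k $ i * a"
      by (simp add: inner_add_right inner_axis)
    ultimately show ?thesis
      by (auto simp: cos_add)
  qed
  moreover have "integral torus_cell (\<lambda>x. cos (k \<bullet> (x + axis i a) + s))
      = integral torus_cell (\<lambda>x. cos (k \<bullet> x + s))"
    using test_function_cos[OF k, of s] a
    by (intro integral_torus_shift) (auto intro!: continuous_intros simp: test_function_def periodic_def)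
  ultimately show ?thesis
    by simp
qed

section \<open>Cosine polynomials as convolution kernels\<close>

text \<open>Linear combinations of the characters \<open>cos (k \<bullet> z)\<close> with integer frequencies. They serve as
convolution kernels \<open>K (x - y)\<close>: the addition theorem separates the variables of each character
into products of test functions, so no differentiation under an integral sign is needed.\<close>

inductive cosine_poly :: "(real ^ 'd \<Rightarrow> real) \<Rightarrow> bool"
  where
    cosine: "(\<And>i. k $ i \<in> \<int>) \<Longrightarrow> cosine_poly (\<lambda>z. cos (k \<bullet> z))"
  | scale: "cosine_poly p \<Longrightarrow> cosine_poly (\<lambda>z. c * p z)"
  | add: "cosine_poly p \<Longrightarrow> cosine_poly q \<Longrightarrow> cosine_poly (\<lambda>z. p z + q z)"

lemma cosine_poly_const: "cosine_poly (\<lambda>_. c)"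
  using cosine_poly.scale[OF cosine_poly.cosine[of 0], of c] by simp

lemma cosine_poly_component: "cosine_poly (\<lambda>z. cos (z $ i))"
proof -
  have "cosine_poly (\<lambda>z. cos (axis i 1 \<bullet> z))"
    by (intro cosine_poly.cosine) (simp add: axis_def)
  then show ?thesis by (simp add: inner_axis')
qed

lemma cosine_poly_mult_cosine:
  assumes k: "\<And>i. k $ i \<in> \<int>" and "cosine_poly q"
  shows "cosine_poly (\<lambda>z. cos (k \<bullet> z) * q z)"
  using assms(2)
proof induction
  case (cosine l)
  have "cosine_poly (\<lambda>z. 1 / 2 * (cos ((k - l) \<bullet> z) + cos ((k + l) \<bullet> z)))"
    using k cosine by (intro cosine_poly.intros) auto
  then show ?case
    by (simp add: cos_times_cos inner_diff_left inner_add_left)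
next
  case (scale p c)
  show ?case using cosine_poly.scale[OF scale.IH, of c] by (simp add: mult_ac)
next
  case (add p q)
  show ?case using cosine_poly.add[OF add.IH] by (simp add: distrib_left)
qed

lemma cosine_poly_mult:
  assumes "cosine_poly p" "cosine_poly q"
  shows "cosine_poly (\<lambda>z. p z * q z)"
  using assms(1)
proof induction
  case (cosine k)
  then show ?case by (rule cosine_poly_mult_cosine) fact
next
  case (scale p c)
  show ?case using cosine_poly.scale[OF scale.IH, of c] by (simp add: mult_ac)
next
  case (add p q)
  show ?case using cosine_poly.add[OF add.IH] by (simp add: distrib_right)
qed

lemma cosine_poly_power: "cosine_poly p \<Longrightarrow> cosine_poly (\<lambda>z. p z ^ n)"
  by (induction n) (auto intro: cosine_poly_const cosine_poly_mult)

lemma cosine_poly_sum: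
  "(\<And>i. i \<in> I \<Longrightarrow> cosine_poly (p i)) \<Longrightarrow> cosine_poly (\<lambda>z. \<Sum>i\<in>I. p i z)"
  by (induction I rule: infinite_finite_induct) (auto intro: cosine_poly_const cosine_poly.add)

lemma cosine_poly_continuous: "cosine_poly p \<Longrightarrow> continuous_on A p"
  by (induction rule: cosine_poly.induct) (intro continuous_intros; assumption)+

lemma cosine_poly_even: "cosine_poly p \<Longrightarrow> p (- z) = p z"
  by (induction rule: cosine_poly.induct) auto

lemma cosine_poly_bounded: "cosine_poly p \<Longrightarrow> \<exists>C. \<forall>z. \<bar>p z\<bar> \<le> C"
proof (induction rule: cosine_poly.induct)
  case (cosine k)
  show ?case by (intro exI[of _ 1]) simp
next
  case (scale p c)
  then obtain C where "\<forall>z. \<bar>p z\<bar> \<le> C" by blast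
  then show ?case
    by (intro exI[of _ "\<bar>c\<bar> * C"]) (simp add: abs_mult mult_left_mono)
next
  case (add p q)
  then obtain C D where "\<forall>z. \<bar>p z\<bar> \<le> C" "\<forall>z. \<bar>q z\<bar> \<le> D" by blast
  then show ?case
    by (intro exI[of _ "C + D"]) (meson abs_triangle_ineq add_mono order_trans)
qed

text \<open>On both sides only the constant term of \<open>p\<close> survives.\<close>

lemma integral_cosine_poly_shift:
  fixes p :: "real ^ 'd \<Rightarrow> real"
  assumes "cosine_poly p"
  shows "(\<integral>y. p (x - y) \<partial>torus_measure) = (\<integral>y. p y \<partial>torus_measure)"
  using assms
proof induction
  case (cosine k)
  show ?case
  proof (cases "k = 0")
    case False
    have "(\<integral>y. cos (l \<bullet> y + s) \<partial>torus_measure) = 0" if "l = k \<or> l = - k" for l s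
    proof -
      have "continuous_on UNIV (\<lambda>y. cos (l \<bullet> y + s))"
        by (intro continuous_intros)
      moreover have "integral torus_cell (\<lambda>y. cos (l \<bullet> y + s)) = 0"
        using that cosine False by (intro integral_torus_cos_eq_0) auto
      ultimately show ?thesis
        by (simp add: integral_torus_measure_continuous)
    qed
    from this[of k 0] this[of "- k" "k \<bullet> x"] show ?thesis
      by (simp add: inner_diff_right add_ac)
  qed simp
next
  case (scale p c)
  then show ?case by simp
next
  case (add p q)
  have "integrable torus_measure (\<lambda>y. r (x - y))" if "cosine_poly r" for r x
    by (intro square_integrable_imp_integrable[OF finite_measure_torus square_integrable_continuous]
        continuous_on_compose2[OF cosine_poly_continuous[OF that]] continuous_intros) auto
  moreover have "integrable torus_measure r" if "cosine_poly r" for r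
    by (intro square_integrable_imp_integrable[OF finite_measure_torus square_integrable_continuous]
        cosine_poly_continuous that)
  ultimately have "integrable torus_measure (\<lambda>y. p (x - y))" "integrable torus_measure (\<lambda>y. q (x - y))"
    "integrable torus_measure p" "integrable torus_measure q"
    using add.hyps by blast+
  then show ?case using add.IH by simp
qed

text \<open>The bilinear form of \<open>L\<^sup>2\<close> obtained from the inner product by mollifying one argument with
\<open>K\<close>.\<close>

definition kernel_form ::
    "(real ^ 'd \<Rightarrow> real) \<Rightarrow> (real ^ 'd \<Rightarrow> real) \<Rightarrow> (real ^ 'd \<Rightarrow> real) \<Rightarrow> real"
  where "kernel_form K f h =
    (\<integral>z. f (fst z) * h (snd z) * K (fst z - snd z) \<partial>(torus_measure \<Otimes>\<^sub>M torus_measure))"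

lemma kernel_measurable:
  assumes "cosine_poly K"
  shows "(\<lambda>z. K (fst z - snd z)) \<in> borel_measurable (torus_measure \<Otimes>\<^sub>M torus_measure)"
proof -
  have [measurable]: "K \<in> borel_measurable borel"
    by (intro borel_measurable_continuous_onI cosine_poly_continuous assms)
  have [measurable]: "fst \<in> measurable (torus_measure \<Otimes>\<^sub>M torus_measure) borel"
    "snd \<in> measurable (torus_measure \<Otimes>\<^sub>M torus_measure) borel"
    using measurable_compose[OF measurable_fst ident_measurable_torus]
      measurable_compose[OF measurable_snd ident_measurable_torus] by auto
  show ?thesis by measurable
qed

lemma kernel_integrable:
  fixes F :: "(real ^ 'd) \<times> (real ^ 'd) \<Rightarrow> real"
  assumes F: "integrable (torus_measure \<Otimes>\<^sub>M torus_measure) F" and K: "cosine_poly K"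
  shows "integrable (torus_measure \<Otimes>\<^sub>M torus_measure) (\<lambda>z. F z * K (fst z - snd z))"
proof -
  obtain C where C: "\<And>z. \<bar>K z\<bar> \<le> C" using cosine_poly_bounded[OF K] by blast
  show ?thesis
  proof (rule Bochner_Integration.integrable_bound)
    show "integrable (torus_measure \<Otimes>\<^sub>M torus_measure) (\<lambda>z. C * F z)"
      using F by simp
    show "AE z in torus_measure \<Otimes>\<^sub>M torus_measure. norm (F z * K (fst z - snd z)) \<le> norm (C * F z)"
    proof (intro AE_I2)
      fix z :: "(real ^ 'd) \<times> (real ^ 'd)"
      have "\<bar>F z\<bar> * \<bar>K (fst z - snd z)\<bar> \<le> \<bar>F z\<bar> * \<bar>C\<bar>"
        using C[of "fst z - snd z"] by (intro mult_left_mono) auto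
      then show "norm (F z * K (fst z - snd z)) \<le> norm (C * F z)"
        by (simp add: abs_mult mult_ac)
    qed
  qed (use F kernel_measurable[OF K] in \<open>auto intro!: borel_measurable_times\<close>)
qed

lemmas torus_pair_integrable =
  integrable_pair_mult[OF finite_measure.axioms(1)[OF finite_measure_torus]
    finite_measure.axioms(1)[OF finite_measure_torus]]

lemmas torus_pair_integral =
  integral_pair_mult[OF finite_measure.axioms(1)[OF finite_measure_torus]
    finite_measure.axioms(1)[OF finite_measure_torus]]

lemma kernel_form_add:
  assumes "integrable torus_measure f" "integrable torus_measure h" "cosine_poly K" "cosine_poly L"
  shows "kernel_form (\<lambda>z. K z + L z) f h = kernel_form K f h + kernel_form L f h"
  unfolding kernel_form_def
  using kernel_integrable[OF torus_pair_integrable[OF assms(1,2)] assms(3)]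
    kernel_integrable[OF torus_pair_integrable[OF assms(1,2)] assms(4)]
  by (simp add: distrib_left)

lemma kernel_form_scale: "kernel_form (\<lambda>z. c * K z) f h = c * kernel_form K f h"
proof -
  have "(\<lambda>z. f (fst z) * h (snd z) * (c * K (fst z - snd z)))
      = (\<lambda>z. c * (f (fst z) * h (snd z) * K (fst z - snd z)))"
    by (auto simp: mult_ac)
  then show ?thesis unfolding kernel_form_def by simp
qed

lemma kernel_form_cosine:
  assumes f: "square_integrable torus_measure f" and h: "square_integrable torus_measure h"
  shows "kernel_form (\<lambda>z. cos (k \<bullet> z)) f h =
    (\<integral>x. f x * cos (k \<bullet> x) \<partial>torus_measure) * (\<integral>x. h x * cos (k \<bullet> x) \<partial>torus_measure)
    + (\<integral>x. f x * sin (k \<bullet> x) \<partial>torus_measure) * (\<integral>x. h x * sin (k \<bullet> x) \<partial>torus_measure)"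
proof -
  have c: "square_integrable torus_measure (\<lambda>x. cos (k \<bullet> x))"
    and s: "square_integrable torus_measure (\<lambda>x. sin (k \<bullet> x))"
    by (intro square_integrable_continuous continuous_intros)+
  note i = square_integrable_mult[OF f c] square_integrable_mult[OF h c]
    square_integrable_mult[OF f s] square_integrable_mult[OF h s]
  have "f (fst z) * h (snd z) * cos (k \<bullet> (fst z - snd z)) =
      (f (fst z) * cos (k \<bullet> fst z)) * (h (snd z) * cos (k \<bullet> snd z))
      + (f (fst z) * sin (k \<bullet> fst z)) * (h (snd z) * sin (k \<bullet> snd z))" for z
    by (simp add: inner_diff_right cos_diff algebra_simps)
  then show ?thesis
    unfolding kernel_form_def
    using torus_pair_integral[OF i(1,2)] torus_pair_integral[OF i(3,4)]
      torus_pair_integrable[OF i(1,2)] torus_pair_integrable[OF i(3,4)]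
    by simp
qed

section \<open>Green's identity for mollified functions\<close>

lemma torus_L2_square_integrable: "torus_L2 f \<Longrightarrow> square_integrable torus_measure f" for f :: "_ \<Rightarrow> real"
  by (simp add: torus_L2_def square_integrable_def)

lemma torus_L2_component:
  assumes "torus_L2 G"
  shows "square_integrable torus_measure (\<lambda>x. G x $ i)"
proof -
  have G: "G \<in> borel_measurable torus_measure" "integrable torus_measure (\<lambda>x. (norm (G x))\<^sup>2)"
    using assms by (auto simp: torus_L2_def)
  have "(\<lambda>y. y $ i) \<in> borel_measurable borel"
    by (intro borel_measurable_continuous_onI continuous_intros)
  with G(1) have m: "(\<lambda>x. G x $ i) \<in> borel_measurable torus_measure"
    by (rule measurable_compose)
  moreover have "integrable torus_measure (\<lambda>x. (G x $ i)\<^sup>2)"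
  proof (rule Bochner_Integration.integrable_bound[OF G(2)])
    show "AE x in torus_measure. norm ((G x $ i)\<^sup>2) \<le> norm ((norm (G x))\<^sup>2)"
    proof (intro AE_I2)
      fix x show "norm ((G x $ i)\<^sup>2) \<le> norm ((norm (G x))\<^sup>2)"
        using component_le_norm_cart[of "G x" i] power_mono[of "\<bar>G x $ i\<bar>" "norm (G x)" 2] by simp
    qed
  qed (rule borel_measurable_power[OF m])
  ultimately show ?thesis by (simp add: square_integrable_def)
qed

text \<open>Testing against the two functions \<open>cos (k \<bullet> x)\<close> and \<open>sin (k \<bullet> x)\<close>; the second is the first with
the phase \<open>- pi / 2\<close>.\<close>

lemma weak_gradient_fourier:
  assumes G: "is_weak_gradient u G" and k: "\<And>i. k $ i \<in> \<int>"
  shows "(\<integral>x. G x $ i * cos (k \<bullet> x) \<partial>torus_measure) = k $ i * (\<integral>x. u x * sin (k \<bullet> x) \<partial>torus_measure)"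
    and "(\<integral>x. G x $ i * sin (k \<bullet> x) \<partial>torus_measure) = - k $ i * (\<integral>x. u x * cos (k \<bullet> x) \<partial>torus_measure)"
proof -
  have G': "(\<integral>x. u x * ((k $ i) * cos (k \<bullet> x + (s + pi / 2))) \<partial>torus_measure)
      = - (\<integral>x. G x $ i * cos (k \<bullet> x + s) \<partial>torus_measure)" for s
    using G[unfolded is_weak_gradient_def, rule_format, OF test_function_cos[OF k, of s], of i]
      partial_cos[of i 1 k s] by (simp only: mult_1)
  have ml: "(\<integral>x. u x * (c * w x) \<partial>torus_measure) = c * (\<integral>x. u x * w x \<partial>torus_measure)" for c w
    by (simp add: mult.left_commute)
  show "(\<integral>x. G x $ i * cos (k \<bullet> x) \<partial>torus_measure) = k $ i * (\<integral>x. u x * sin (k \<bullet> x) \<partial>torus_measure)"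
    using G'[of 0] by (simp add: ml cos_add)
  show "(\<integral>x. G x $ i * sin (k \<bullet> x) \<partial>torus_measure) = - k $ i * (\<integral>x. u x * cos (k \<bullet> x) \<partial>torus_measure)"
    using G'[of "- pi / 2"] by (simp add: ml cos_add cos_diff)
qed

lemma weak_laplacian_fourier:
  assumes g: "is_weak_laplacian u g" and k: "\<And>i. k $ i \<in> \<int>"
  shows "(\<integral>x. g x * cos (k \<bullet> x) \<partial>torus_measure)
      = - (\<Sum>i\<in>UNIV. (k $ i)\<^sup>2) * (\<integral>x. u x * cos (k \<bullet> x) \<partial>torus_measure)"
    and "(\<integral>x. g x * sin (k \<bullet> x) \<partial>torus_measure)
      = - (\<Sum>i\<in>UNIV. (k $ i)\<^sup>2) * (\<integral>x. u x * sin (k \<bullet> x) \<partial>torus_measure)"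
proof -
  define c where "c = - (\<Sum>i\<in>UNIV. (k $ i)\<^sup>2)"
  have g': "(\<integral>x. u x * (c * cos (k \<bullet> x + s)) \<partial>torus_measure)
      = (\<integral>x. g x * cos (k \<bullet> x + s) \<partial>torus_measure)" for s
    using g[unfolded is_weak_laplacian_def, rule_format, OF test_function_cos[OF k]]
    by (simp only: laplacian_cos c_def)
  have ml: "(\<integral>x. u x * (c * w x) \<partial>torus_measure) = c * (\<integral>x. u x * w x \<partial>torus_measure)" for w
    by (simp add: mult.left_commute)
  show "(\<integral>x. g x * cos (k \<bullet> x) \<partial>torus_measure)
      = - (\<Sum>i\<in>UNIV. (k $ i)\<^sup>2) * (\<integral>x. u x * cos (k \<bullet> x) \<partial>torus_measure)"
    using g'[of 0] unfolding ml unfolding c_def by simp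
  show "(\<integral>x. g x * sin (k \<bullet> x) \<partial>torus_measure)
      = - (\<Sum>i\<in>UNIV. (k $ i)\<^sup>2) * (\<integral>x. u x * sin (k \<bullet> x) \<partial>torus_measure)"
    using g'[of "- pi / 2"] unfolding ml unfolding c_def by (simp add: cos_diff)
qed

text \<open>A mollified \<open>v\<close> is a smooth test function, so here Green's identity is exact. For a single
character of frequency \<open>k\<close> it is the equality of the symbols: the Laplacian multiplies a Fourier
coefficient by minus the squared length of \<open>k\<close>, which is what the two gradients contribute
together.\<close>

lemma kernel_form_Green:
  fixes w v :: "real ^ 'd \<Rightarrow> real"
  assumes g: "torus_L2 g" "is_weak_laplacian w g"
    and G: "torus_L2 G" "is_weak_gradient w G"
    and v: "torus_L2 v" and H: "torus_L2 H" "is_weak_gradient v H"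
    and K: "cosine_poly K"
  shows "kernel_form K g v = - (\<Sum>i\<in>UNIV. kernel_form K (\<lambda>x. G x $ i) (\<lambda>x. H x $ i))"
  using K
proof induction
  case (cosine k)
  define A B C D where "A = (\<integral>x. w x * cos (k \<bullet> x) \<partial>torus_measure)"
    and "B = (\<integral>x. w x * sin (k \<bullet> x) \<partial>torus_measure)"
    and "C = (\<integral>x. v x * cos (k \<bullet> x) \<partial>torus_measure)"
    and "D = (\<integral>x. v x * sin (k \<bullet> x) \<partial>torus_measure)"
  have "kernel_form (\<lambda>z. cos (k \<bullet> z)) (\<lambda>x. G x $ i) (\<lambda>x. H x $ i) = (k $ i)\<^sup>2 * (A * C + B * D)" for i
    unfolding kernel_form_cosine[OF torus_L2_component[OF G(1)] torus_L2_component[OF H(1)]]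
      weak_gradient_fourier[OF G(2) cosine] weak_gradient_fourier[OF H(2) cosine]
      A_def[symmetric] B_def[symmetric] C_def[symmetric] D_def[symmetric]
    by (simp add: power2_eq_square algebra_simps)
  then have "(\<Sum>i\<in>UNIV. kernel_form (\<lambda>z. cos (k \<bullet> z)) (\<lambda>x. G x $ i) (\<lambda>x. H x $ i))
      = (\<Sum>i\<in>UNIV. (k $ i)\<^sup>2) * (A * C + B * D)"
    by (simp add: sum_distrib_right)
  moreover have "kernel_form (\<lambda>z. cos (k \<bullet> z)) g v = - (\<Sum>i\<in>UNIV. (k $ i)\<^sup>2) * (A * C + B * D)"
    unfolding kernel_form_cosine[OF torus_L2_square_integrable[OF g(1)] torus_L2_square_integrable[OF v]]
      weak_laplacian_fourier[OF g(2) cosine]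
      A_def[symmetric] B_def[symmetric] C_def[symmetric] D_def[symmetric]
    by (simp add: algebra_simps)
  ultimately show ?case by simp
next
  case (scale p c)
  then show ?case by (simp add: kernel_form_scale sum_distrib_left)
next
  case (add p q)
  note int = square_integrable_imp_integrable[OF finite_measure_torus]
  show ?case
    using add
    by (simp add: sum.distrib
        kernel_form_add[OF int[OF torus_L2_square_integrable[OF g(1)]] int[OF torus_L2_square_integrable[OF v]]]
        kernel_form_add[OF int[OF torus_L2_component[OF G(1)]] int[OF torus_L2_component[OF H(1)]]])
qed

section \<open>The error of mollification\<close>

text \<open>For a kernel that integrates to one, twice the gap between the squared norm of \<open>f\<close> and
\<open>kernel_form K f f\<close>: an average of squared
differences, which is small when \<open>K\<close> concentrates at the origin.\<close>

definition kernel_energy :: "(real ^ 'd \<Rightarrow> real) \<Rightarrow> (real ^ 'd \<Rightarrow> real) \<Rightarrow> real"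
  where "kernel_energy K f =
    (\<integral>z. (f (fst z) - f (snd z))\<^sup>2 * K (fst z - snd z) \<partial>(torus_measure \<Otimes>\<^sub>M torus_measure))"

definition prob_kernel :: "(real ^ 'd \<Rightarrow> real) \<Rightarrow> bool"
  where "prob_kernel K \<longleftrightarrow> cosine_poly K \<and> (\<forall>z. 0 \<le> K z) \<and> (\<integral>z. K z \<partial>torus_measure) = 1"

lemma
  fixes F :: "real ^ 'd \<Rightarrow> real"
  assumes F: "integrable torus_measure F" and K: "cosine_poly K"
  shows kernel_integrable_fst:
      "integrable (torus_measure \<Otimes>\<^sub>M torus_measure) (\<lambda>z. F (fst z) * K (fst z - snd z))"
    and kernel_integrable_snd:
      "integrable (torus_measure \<Otimes>\<^sub>M torus_measure) (\<lambda>z. F (snd z) * K (fst z - snd z))"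
    and kernel_integral_fst:
      "(\<integral>z. F (fst z) * K (fst z - snd z) \<partial>(torus_measure \<Otimes>\<^sub>M torus_measure))
        = (\<integral>x. F x \<partial>torus_measure) * (\<integral>z. K z \<partial>torus_measure)"
    and kernel_integral_snd:
      "(\<integral>z. F (snd z) * K (fst z - snd z) \<partial>(torus_measure \<Otimes>\<^sub>M torus_measure))
        = (\<integral>x. F x \<partial>torus_measure) * (\<integral>z. K z \<partial>torus_measure)"
proof -
  have one: "integrable torus_measure (\<lambda>x :: real ^ 'd. 1 :: real)"
    by (rule torus.integrable_const)
  show i1: "integrable (torus_measure \<Otimes>\<^sub>M torus_measure) (\<lambda>z. F (fst z) * K (fst z - snd z))"
    using kernel_integrable[OF torus_pair_integrable[OF F one] K] by simp
  show i2: "integrable (torus_measure \<Otimes>\<^sub>M torus_measure) (\<lambda>z. F (snd z) * K (fst z - snd z))"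
    using kernel_integrable[OF torus_pair_integrable[OF one F] K] by simp
  have "(\<integral>z. F (fst z) * K (fst z - snd z) \<partial>(torus_measure \<Otimes>\<^sub>M torus_measure))
      = (\<integral>x. (\<integral>y. F x * K (x - y) \<partial>torus_measure) \<partial>torus_measure)"
    using torus2.integral_fst'[OF i1] by simp
  then show "(\<integral>z. F (fst z) * K (fst z - snd z) \<partial>(torus_measure \<Otimes>\<^sub>M torus_measure))
      = (\<integral>x. F x \<partial>torus_measure) * (\<integral>z. K z \<partial>torus_measure)"
    by (simp add: integral_cosine_poly_shift[OF K])
  have even: "K (x - y) = K (y - x)" for x y
    using cosine_poly_even[OF K, of "x - y"] by simp
  have "(\<integral>z. F (snd z) * K (fst z - snd z) \<partial>(torus_measure \<Otimes>\<^sub>M torus_measure))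
      = (\<integral>y. (\<integral>x. F y * K (x - y) \<partial>torus_measure) \<partial>torus_measure)"
    using torus2.integral_snd[of "\<lambda>x y. F y * K (x - y)", unfolded case_prod_beta', OF i2] by simp
  also have "\<dots> = (\<integral>y. (\<integral>x. F y * K (y - x) \<partial>torus_measure) \<partial>torus_measure)"
    by (subst even) (rule refl)
  finally show "(\<integral>z. F (snd z) * K (fst z - snd z) \<partial>(torus_measure \<Otimes>\<^sub>M torus_measure))
      = (\<integral>x. F x \<partial>torus_measure) * (\<integral>z. K z \<partial>torus_measure)"
    by (simp add: integral_cosine_poly_shift[OF K])
qed

lemma kernel_form_commute:
  assumes f: "integrable torus_measure f" and h: "integrable torus_measure h" and K: "cosine_poly K"
  shows "kernel_form K f h = kernel_form K h f"
proof -
  have even: "K (x - y) = K (y - x)" for x y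
    using cosine_poly_even[OF K, of "x - y"] by simp
  have "(\<integral>(x, y). f y * h x * K (y - x) \<partial>(torus_measure \<Otimes>\<^sub>M torus_measure)) = kernel_form K f h"
    using torus2.integral_product_swap[OF borel_measurable_integrable[OF
          kernel_integrable[OF torus_pair_integrable[OF f h] K]]]
    by (simp add: kernel_form_def)
  moreover have "(\<integral>(x, y). f y * h x * K (y - x) \<partial>(torus_measure \<Otimes>\<^sub>M torus_measure)) = kernel_form K h f"
    unfolding kernel_form_def case_prod_beta by (subst even) (simp add: mult_ac)
  ultimately show ?thesis by simp
qed

lemma kernel_energy_integrable:
  assumes f: "square_integrable torus_measure f" and K: "cosine_poly K"
  shows "integrable (torus_measure \<Otimes>\<^sub>M torus_measure) (\<lambda>z. (f (fst z) - f (snd z))\<^sup>2 * K (fst z - snd z))"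
proof -
  have f2: "integrable torus_measure (\<lambda>x. (f x)\<^sup>2)" and f1: "integrable torus_measure f"
    using f square_integrable_imp_integrable[OF finite_measure_torus f] by (auto simp: square_integrable_def)
  have "integrable (torus_measure \<Otimes>\<^sub>M torus_measure) (\<lambda>z. (f (fst z))\<^sup>2 * K (fst z - snd z)
      + (f (snd z))\<^sup>2 * K (fst z - snd z) - 2 * (f (fst z) * f (snd z) * K (fst z - snd z)))"
    using kernel_integrable_fst[OF f2 K] kernel_integrable_snd[OF f2 K]
      kernel_integrable[OF torus_pair_integrable[OF f1 f1] K] by simp
  then show ?thesis
    by (simp add: power2_diff algebra_simps)
qed

text \<open>Since \<open>K\<close> is even and integrates to one in each variable, the difference on the left is half the
integral of \<open>(f x - f y) * (h x - h y) * K (x - y)\<close>. Pointwise \<open>\<bar>a * b\<bar> \<le> (a\<^sup>2 + b\<^sup>2) / 2\<close> then applies because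
\<open>K\<close> is nonnegative.\<close>

lemma kernel_form_error:
  fixes f h :: "real ^ 'd \<Rightarrow> real"
  assumes f: "square_integrable torus_measure f" and h: "square_integrable torus_measure h"
    and K: "prob_kernel K"
  shows "\<bar>(\<integral>x. f x * h x \<partial>torus_measure) - kernel_form K f h\<bar> \<le> (kernel_energy K f + kernel_energy K h) / 4"
proof -
  have cK: "cosine_poly K" and K0: "\<And>z. 0 \<le> K z" and K1: "(\<integral>z. K z \<partial>torus_measure) = 1"
    using K by (auto simp: prob_kernel_def)
  define P :: "((real ^ 'd) \<times> (real ^ 'd)) measure" where "P = torus_measure \<Otimes>\<^sub>M torus_measure"
  have f1: "integrable torus_measure f" and h1: "integrable torus_measure h"
    using square_integrable_imp_integrable[OF finite_measure_torus] f h by auto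
  note fh = square_integrable_mult[OF f h]
  note i = kernel_integrable_fst[OF fh cK, folded P_def] kernel_integrable_snd[OF fh cK, folded P_def]
    kernel_integrable[OF torus_pair_integrable[OF f1 h1] cK, folded P_def]
    kernel_integrable[OF torus_pair_integrable[OF h1 f1] cK, folded P_def]
  note ie = kernel_energy_integrable[OF f cK, folded P_def] kernel_energy_integrable[OF h cK, folded P_def]
  have expand: "(f (fst z) - f (snd z)) * (h (fst z) - h (snd z)) * K (fst z - snd z)
      = f (fst z) * h (fst z) * K (fst z - snd z) + f (snd z) * h (snd z) * K (fst z - snd z)
        - f (fst z) * h (snd z) * K (fst z - snd z) - h (fst z) * f (snd z) * K (fst z - snd z)" for z
    by (simp add: algebra_simps)
  have ip: "integrable P (\<lambda>z. (f (fst z) - f (snd z)) * (h (fst z) - h (snd z)) * K (fst z - snd z))"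
    unfolding expand using i by simp
  have eq: "(\<integral>z. (f (fst z) - f (snd z)) * (h (fst z) - h (snd z)) * K (fst z - snd z) \<partial>P)
      = 2 * ((\<integral>x. f x * h x \<partial>torus_measure) - kernel_form K f h)"
    unfolding expand
    using i kernel_integral_fst[OF fh cK] kernel_integral_snd[OF fh cK] kernel_form_commute[OF h1 f1 cK]
    by (simp add: kernel_form_def K1 flip: P_def)
  have "\<bar>\<integral>z. (f (fst z) - f (snd z)) * (h (fst z) - h (snd z)) * K (fst z - snd z) \<partial>P\<bar>
      \<le> (\<integral>z. \<bar>(f (fst z) - f (snd z)) * (h (fst z) - h (snd z)) * K (fst z - snd z)\<bar> \<partial>P)"
    by (rule integral_abs_bound)
  also have "\<dots> \<le> (\<integral>z. ((f (fst z) - f (snd z))\<^sup>2 * K (fst z - snd z)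
      + (h (fst z) - h (snd z))\<^sup>2 * K (fst z - snd z)) / 2 \<partial>P)"
  proof (rule integral_mono)
    fix z
    show "\<bar>(f (fst z) - f (snd z)) * (h (fst z) - h (snd z)) * K (fst z - snd z)\<bar>
        \<le> ((f (fst z) - f (snd z))\<^sup>2 * K (fst z - snd z) + (h (fst z) - h (snd z))\<^sup>2 * K (fst z - snd z)) / 2"
      using mult_right_mono[OF abs_mult_le_sum_squares K0, of "f (fst z) - f (snd z)" "h (fst z) - h (snd z)"]
        K0[of "fst z - snd z"]
      by (simp add: abs_mult distrib_right)
  qed (use ip ie in auto)
  also have "\<dots> = (kernel_energy K f + kernel_energy K h) / 2"
    using ie by (simp add: kernel_energy_def flip: P_def)
  finally show ?thesis
    unfolding eq abs_mult by simp
qed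

text \<open>The kernel energy is stable in \<open>L\<^sup>2\<close> uniformly in the kernel, which reduces its convergence to
continuous functions.\<close>

lemma kernel_energy_approx:
  fixes f p :: "real ^ 'd \<Rightarrow> real"
  assumes f: "square_integrable torus_measure f" and p: "square_integrable torus_measure p"
    and K: "prob_kernel K"
  shows "kernel_energy K f \<le> 6 * (\<integral>x. (f x - p x)\<^sup>2 \<partial>torus_measure) + 3 * kernel_energy K p"
proof -
  have cK: "cosine_poly K" and K0: "\<And>z. 0 \<le> K z" and K1: "(\<integral>z. K z \<partial>torus_measure) = 1"
    using K by (auto simp: prob_kernel_def)
  have d: "integrable torus_measure (\<lambda>x. (f x - p x)\<^sup>2)"
    using square_integrable_diff[OF f p] by (simp add: square_integrable_def)
  note i = kernel_integrable_fst[OF d cK] kernel_integrable_snd[OF d cK] kernel_energy_integrable[OF p cK]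
  have "kernel_energy K f \<le> (\<integral>z. 3 * ((f (fst z) - p (fst z))\<^sup>2 * K (fst z - snd z))
      + 3 * ((f (snd z) - p (snd z))\<^sup>2 * K (fst z - snd z))
      + 3 * ((p (fst z) - p (snd z))\<^sup>2 * K (fst z - snd z)) \<partial>(torus_measure \<Otimes>\<^sub>M torus_measure))"
    unfolding kernel_energy_def
  proof (rule integral_mono)
    fix z :: "(real ^ 'd) \<times> (real ^ 'd)"
    have three: "(a - b)\<^sup>2 \<le> 3 * (a - c)\<^sup>2 + 3 * (b - d)\<^sup>2 + 3 * (c - d)\<^sup>2" for a b c d :: real
    proof -
      have "3 * (r\<^sup>2 + s\<^sup>2 + t\<^sup>2) - (r - s + t)\<^sup>2 = (r + s)\<^sup>2 + (r - t)\<^sup>2 + (s + t)\<^sup>2" for r s t :: real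
        by (simp add: power2_eq_square algebra_simps)
      from this[of "a - c" "b - d" "c - d"] show ?thesis
        using zero_le_power2[of "a - c + (b - d)"] zero_le_power2[of "a - c - (c - d)"]
          zero_le_power2[of "b - d + (c - d)"] by (simp add: algebra_simps)
    qed
    show "(f (fst z) - f (snd z))\<^sup>2 * K (fst z - snd z)
        \<le> 3 * ((f (fst z) - p (fst z))\<^sup>2 * K (fst z - snd z))
      + 3 * ((f (snd z) - p (snd z))\<^sup>2 * K (fst z - snd z))
      + 3 * ((p (fst z) - p (snd z))\<^sup>2 * K (fst z - snd z))"
      using mult_right_mono[OF three[of "f (fst z)" "f (snd z)" "p (fst z)" "p (snd z)"] K0[of "fst z - snd z"]]
      by (simp add: distrib_right)
  qed (use i kernel_energy_integrable[OF f cK] in auto)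
  also have "\<dots> = 6 * (\<integral>x. (f x - p x)\<^sup>2 \<partial>torus_measure) + 3 * kernel_energy K p"
    using i kernel_integral_fst[OF d cK] kernel_integral_snd[OF d cK]
    by (simp add: kernel_energy_def K1)
  finally show ?thesis .
qed

section \<open>Kernels that concentrate at the origin\<close>

text \<open>A high power of \<open>q\<close> puts almost all its mass where \<open>q\<close> is close to its supremum \<open>m\<close>. On
\<open>{m - e < q}\<close> the factor \<open>m - q\<close> is below \<open>e\<close>; the rest contributes at most a multiple of
\<open>(m - e) ^ n\<close>, which is exponentially smaller than the lower bound \<open>(m - e / 2) ^ n * c\<close> for the
total mass.\<close>

lemma (in finite_measure)
  assumes q[measurable]: "q \<in> borel_measurable M" and q0: "\<And>x. 0 \<le> q x" and qm: "\<And>x. q x \<le> m"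
    and m: "(m :: real) > 0"
    and pos: "\<And>e. e > 0 \<Longrightarrow> measure M {x \<in> space M. m - e < q x} > 0"
  shows integral_power_pos: "0 < (\<integral>x. q x ^ n \<partial>M)"
    and integral_power_concentration:
      "(\<lambda>n. (\<integral>x. (m - q x) * q x ^ n \<partial>M) / (\<integral>x. q x ^ n \<partial>M)) \<longlonglongrightarrow> 0"
proof -
  define V where "V = measure M (space M)"
  have pw: "q x ^ n \<le> m ^ n" "0 \<le> q x ^ n" for x n
    using power_mono[OF qm q0] q0 by auto
  have int: "integrable M (\<lambda>x. q x ^ n)" for n
    using pw by (intro integrable_const_bound[where B="m ^ n"] AE_I2) auto
  have int': "integrable M (\<lambda>x. (m - q x) * q x ^ n)" for n
    using int[of n] int[of "Suc n"] by (simp add: left_diff_distrib)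
  have lower: "(m - e) ^ n * measure M {x \<in> space M. m - e < q x} \<le> (\<integral>x. q x ^ n \<partial>M)"
    if "e < m" for e n
  proof -
    have "(m - e) ^ n * measure M {x \<in> space M. m - e < q x}
        = (\<integral>x. (m - e) ^ n * indicator {x \<in> space M. m - e < q x} x \<partial>M)"
      by (simp add: Int_absorb2)
    also have "\<dots> \<le> (\<integral>x. q x ^ n \<partial>M)"
    proof (rule integral_mono)
      show "integrable M (\<lambda>x. (m - e) ^ n * indicator {x \<in> space M. m - e < q x} x)"
        by (intro integrable_mult_right integrable_real_indicator) (auto simp: emeasure_eq_measure)
      fix x
      show "(m - e) ^ n * indicator {x \<in> space M. m - e < q x} x \<le> q x ^ n"
        using that pw[of x n] by (auto simp: indicator_def intro!: power_mono)
    qed (rule int)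
    finally show ?thesis .
  qed
  have posn: "0 < (\<integral>x. q x ^ n \<partial>M)" for n
    using lower[of "m / 2" n] pos[of "m / 2"] m
    by (smt (verit) field_sum_of_halves mult_pos_pos zero_less_power)
  then show "0 < (\<integral>x. q x ^ n \<partial>M)" .
  have upper: "(\<integral>x. (m - q x) * q x ^ n \<partial>M) \<le> e * (\<integral>x. q x ^ n \<partial>M) + m * (m - e) ^ n * V"
    if e: "0 < e" "e < m" for e n
  proof -
    have "(\<integral>x. (m - q x) * q x ^ n \<partial>M) \<le> (\<integral>x. e * q x ^ n + m * (m - e) ^ n \<partial>M)"
    proof (rule integral_mono)
      show "integrable M (\<lambda>x. e * q x ^ n + m * (m - e) ^ n)"
        using int by simp
      fix x
      show "(m - q x) * q x ^ n \<le> e * q x ^ n + m * (m - e) ^ n"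
      proof (cases "m - e < q x")
        case True
        then have "(m - q x) * q x ^ n \<le> e * q x ^ n" using pw[of x n] by (intro mult_right_mono) auto
        moreover have "0 \<le> m * (m - e) ^ n" using e m by simp
        ultimately show ?thesis by linarith
      next
        case False
        then have "(m - q x) * q x ^ n \<le> m * (m - e) ^ n"
          using q0[of x] m by (intro mult_mono power_mono) auto
        moreover have "0 \<le> e * q x ^ n" using e pw[of x n] by simp
        ultimately show ?thesis by linarith
      qed
    qed (rule int')
    also have "\<dots> = e * (\<integral>x. q x ^ n \<partial>M) + m * (m - e) ^ n * V"
      using int by (simp add: V_def)
    finally show ?thesis .
  qed
  show "(\<lambda>n. (\<integral>x. (m - q x) * q x ^ n \<partial>M) / (\<integral>x. q x ^ n \<partial>M)) \<longlonglongrightarrow> 0"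
  proof (rule order_tendstoI)
    fix a :: real assume "a < 0"
    have "0 \<le> (\<integral>x. (m - q x) * q x ^ n \<partial>M)" for n
      using qm pw by (intro integral_nonneg_AE AE_I2 mult_nonneg_nonneg) (auto simp: algebra_simps)
    then show "\<forall>\<^sub>F n in sequentially. a < (\<integral>x. (m - q x) * q x ^ n \<partial>M) / (\<integral>x. q x ^ n \<partial>M)"
      using posn \<open>a < 0\<close> by (intro always_eventually allI) (metis divide_nonneg_pos less_le_trans)
  next
    fix a :: real assume a: "0 < a"
    define e where "e = min (a / 2) (m / 2)"
    have e: "0 < e" "e < m" "e \<le> a / 2" using a m by (auto simp: e_def min_def)
    define c where "c = measure M {x \<in> space M. m - e / 2 < q x}"
    have c: "0 < c" using pos[of "e / 2"] e by (simp add: c_def)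
    define r where "r = (m - e) / (m - e / 2)"
    have r: "0 \<le> r" "r < 1" using e by (auto simp: r_def field_simps)
    have bound: "(\<integral>x. (m - q x) * q x ^ n \<partial>M) / (\<integral>x. q x ^ n \<partial>M) \<le> e + m * V / c * r ^ n" for n
    proof -
      have I: "(m - e / 2) ^ n * c \<le> (\<integral>x. q x ^ n \<partial>M)" using lower[of "e / 2" n] e by (simp add: c_def)
      have J: "0 < (m - e / 2) ^ n * c" using c e by simp
      have "m * (m - e) ^ n * V / (\<integral>x. q x ^ n \<partial>M) \<le> m * (m - e) ^ n * V / ((m - e / 2) ^ n * c)"
        using I J m e by (intro divide_left_mono) (auto simp: V_def intro!: mult_nonneg_nonneg mult_pos_pos posn)
      also have "\<dots> = m * V / c * r ^ n"
        by (simp add: r_def power_divide mult_ac)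
      finally show ?thesis
        using divide_right_mono[OF upper[OF e(1,2), of n] less_imp_le[OF posn[of n]]] posn[of n]
        by (simp add: add_divide_distrib)
    qed
    have "(\<lambda>n. e + m * V / c * r ^ n) \<longlonglongrightarrow> e + m * V / c * 0"
      using r by (intro tendsto_intros LIMSEQ_power_zero) auto
    then have "\<forall>\<^sub>F n in sequentially. e + m * V / c * r ^ n < a"
      by (rule order_tendstoD) (use a e in auto)
    then show "\<forall>\<^sub>F n in sequentially. (\<integral>x. (m - q x) * q x ^ n \<partial>M) / (\<integral>x. q x ^ n \<partial>M) < a"
      by eventually_elim (use bound in \<open>blast intro: le_less_trans\<close>)
  qed
qed

text \<open>A trigonometric substitute for half the squared distance: near the origin it behaves like
\<open>z \<bullet> z / 2\<close>, and it vanishes exactly on the lattice of periods.\<close>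

definition torus_dist :: "real ^ 'd \<Rightarrow> real"
  where "torus_dist z = (\<Sum>i\<in>UNIV. 1 - cos (z $ i))"

lemma torus_dist_nonneg: "0 \<le> torus_dist z"
  unfolding torus_dist_def by (intro sum_nonneg) simp

lemma cosine_poly_torus_dist: "cosine_poly torus_dist"
proof -
  have "cosine_poly (\<lambda>z :: real ^ 'd. \<Sum>i\<in>UNIV. 1 + (- 1) * cos (z $ i))"
    by (intro cosine_poly_sum cosine_poly.add cosine_poly.scale cosine_poly_const cosine_poly_component)
  then show ?thesis by (simp add: torus_dist_def[abs_def])
qed

lemma torus_dist_eq_0:
  assumes "x \<in> torus_cell" "y \<in> torus_cell" "torus_dist (x - y) = 0" "x \<noteq> y"
  shows "x \<notin> interior torus_cell \<and> y \<notin> interior torus_cell"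
proof -
  have cos1: "cos (x $ i - y $ i) = 1" for i
    using assms(3) unfolding torus_dist_def by (subst (asm) sum_nonneg_eq_0_iff) auto
  obtain i where i: "x $ i \<noteq> y $ i" using assms(4) by (auto simp: vec_eq_iff)
  have b: "- pi \<le> x $ i" "x $ i \<le> pi" "- pi \<le> y $ i" "y $ i \<le> pi"
    using assms(1,2) by (auto simp: torus_cell_def mem_box_cart)
  obtain n :: int where n: "x $ i - y $ i = of_int n * 2 * pi"
    using cos1[of i] cos_one_2pi_int by blast
  have "n \<noteq> 0" using n i by auto
  then have "1 \<le> \<bar>real_of_int n\<bar>" by linarith
  then have "2 * pi \<le> \<bar>x $ i - y $ i\<bar>"
    unfolding n by (simp add: abs_mult)
  then have "(x $ i = pi \<and> y $ i = - pi) \<or> (x $ i = - pi \<and> y $ i = pi)"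
    using b by linarith
  then show ?thesis
    unfolding interior_torus_cell mem_box_cart by (auto intro!: exI[of _ i])
qed

text \<open>A Korovkin-type estimate. The pairs with \<open>(p x - p y)\<^sup>2 \<ge> e\<close> form a compact set on which the torus
distance is positive: its zeros in the cell are the diagonal and pairs of identified points of the
frontier, where \<open>p\<close> vanishes. Hence it has a positive minimum on that set.\<close>

lemma continuous_diff_le_torus_dist:
  fixes p :: "real ^ 'd \<Rightarrow> real"
  assumes cont: "continuous_on UNIV p" and zero: "\<And>x. x \<notin> interior torus_cell \<Longrightarrow> p x = 0"
    and e: "0 < e"
  obtains C where "0 \<le> C" and "\<And>x y. x \<in> torus_cell \<Longrightarrow> y \<in> torus_cell \<Longrightarrow>
    (p x - p y)\<^sup>2 \<le> e + C * torus_dist (x - y)"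
proof -
  define Q :: "((real ^ 'd) \<times> (real ^ 'd)) set" where "Q = torus_cell \<times> torus_cell"
  define D where "D z = (p (fst z) - p (snd z))\<^sup>2" for z
  define r :: "(real ^ 'd) \<times> (real ^ 'd) \<Rightarrow> real" where "r z = torus_dist (fst z - snd z)" for z
  define S where "S = Q \<inter> D -` {e..}"
  have cD: "continuous_on A D" for A
    unfolding D_def by (intro continuous_intros continuous_on_compose2[OF cont]) auto
  have cr: "continuous_on A r" for A
    unfolding r_def by (intro continuous_on_compose2[OF cosine_poly_continuous[OF cosine_poly_torus_dist]]
        continuous_intros) auto
  have Q: "compact Q" unfolding Q_def by (intro compact_Times compact_torus_cell)
  have "compact S"
    unfolding S_def by (intro compact_Int_closed Q closed_vimage closed_atLeast cD)
  have "bounded (D ` Q)"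
    by (intro compact_imp_bounded compact_continuous_image cD Q)
  then obtain M where M: "\<And>z. z \<in> Q \<Longrightarrow> \<bar>D z\<bar> \<le> M" by (auto simp: bounded_iff)
  show ?thesis
  proof (cases "S = {}")
    case True
    show ?thesis
    proof (rule that[of 0])
      fix x y :: "real ^ 'd" assume "x \<in> torus_cell" "y \<in> torus_cell"
      then have "(x, y) \<in> Q" by (simp add: Q_def)
      then have "D (x, y) < e" using True by (auto simp: S_def)
      then show "(p x - p y)\<^sup>2 \<le> e + 0 * torus_dist (x - y)" by (simp add: D_def)
    qed simp
  next
    case False
    obtain z0 where z0: "z0 \<in> S" "\<And>z. z \<in> S \<Longrightarrow> r z0 \<le> r z"
      using continuous_attains_inf[OF \<open>compact S\<close> False cr] by blast
    have "0 < r z0"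
    proof (rule ccontr)
      assume "\<not> 0 < r z0"
      then have "torus_dist (fst z0 - snd z0) = 0"
        using torus_dist_nonneg[of "fst z0 - snd z0"] by (simp add: r_def)
      moreover have "fst z0 \<in> torus_cell" "snd z0 \<in> torus_cell"
        using z0(1) by (auto simp: S_def Q_def)
      ultimately have "fst z0 = snd z0 \<or> (p (fst z0) = 0 \<and> p (snd z0) = 0)"
        using torus_dist_eq_0 zero by blast
      then have "D z0 = 0" by (auto simp: D_def)
      then show False using z0(1) e by (simp add: S_def)
    qed
    have "0 \<le> M" using M[of z0] z0(1) by (auto simp: S_def)
    show ?thesis
    proof (rule that[of "M / r z0"])
      show "0 \<le> M / r z0" using \<open>0 \<le> M\<close> \<open>0 < r z0\<close> by simp
      fix x y :: "real ^ 'd" assume "x \<in> torus_cell" "y \<in> torus_cell"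
      then have xy: "(x, y) \<in> Q" by (simp add: Q_def)
      show "(p x - p y)\<^sup>2 \<le> e + M / r z0 * torus_dist (x - y)"
      proof (cases "(x, y) \<in> S")
        case True
        have "M * 1 \<le> M * (r (x, y) / r z0)"
          using \<open>0 \<le> M\<close> \<open>0 < r z0\<close> z0(2)[OF True] by (intro mult_left_mono) simp_all
        then show ?thesis using M[OF xy] e by (simp add: D_def r_def)
      next
        case False
        then have "D (x, y) < e" using xy by (auto simp: S_def)
        moreover have "0 \<le> M / r z0 * torus_dist (x - y)"
          using \<open>0 \<le> M\<close> \<open>0 < r z0\<close> torus_dist_nonneg[of "x - y"] by simp
        ultimately show ?thesis by (simp add: D_def)
      qed
    qed
  qed
qed

text \<open>The normalised powers of \<open>q z = (\<Sum>i\<in>UNIV. 1 + cos (z $ i))\<close>. This \<open>q\<close> is itself a cosine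
polynomial, and its distance \<open>m - q\<close> from its maximum is the torus distance, so concentration near
the maximum is concentration near the origin.\<close>

lemma approximate_identity_exists:
  obtains K :: "nat \<Rightarrow> real ^ 'd \<Rightarrow> real" where "\<And>n. prob_kernel (K n)"
    and "(\<lambda>n. \<integral>z. torus_dist z * K n z \<partial>torus_measure) \<longlonglongrightarrow> 0"
proof -
  define m where "m = 2 * real CARD('d)"
  define q :: "real ^ 'd \<Rightarrow> real" where "q z = m - torus_dist z" for z
  have q_sum: "q z = (\<Sum>i\<in>UNIV. 1 + cos (z $ i))" for z
    by (simp add: q_def m_def torus_dist_def sum.distrib sum_subtractf)
  have cq: "cosine_poly q"
    using cosine_poly.add[OF cosine_poly_const[of m] cosine_poly.scale[OF cosine_poly_torus_dist, of "-1"]]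
    by (simp add: q_def[abs_def])
  have q0: "0 \<le> q z" for z
    unfolding q_sum by (intro sum_nonneg) (smt (verit) cos_ge_minus_one)
  have qm: "q z \<le> m" for z
    using torus_dist_nonneg[of z] by (simp add: q_def)
  have m: "0 < m" by (simp add: m_def)
  have mq: "q \<in> borel_measurable torus_measure"
    by (intro borel_measurable_torus borel_measurable_continuous_onI cosine_poly_continuous cq)
  have pos: "0 < measure torus_measure {z \<in> space torus_measure. m - e < q z}" if "0 < e" for e
  proof -
    define U where "U = interior torus_cell \<inter> {z. m - e < q z}"
    have "open U"
      unfolding U_def by (intro open_Int open_interior open_Collect_less continuous_on_const
          cosine_poly_continuous cq)
    moreover have "0 \<in> U"
      using that pi_gt_zero by (auto simp: U_def interior_torus_cell mem_box_cart q_def torus_dist_def)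
    ultimately have "\<not> negligible U"
      using open_not_negligible by blast
    have sets: "{z \<in> space torus_measure. m - e < q z} \<in> sets torus_measure"
      using mq by measurable
    have "U \<subseteq> {z \<in> space torus_measure. m - e < q z}"
      using interior_subset by (auto simp: U_def)
    with \<open>\<not> negligible U\<close> have "\<not> negligible {z \<in> space torus_measure. m - e < q z}"
      using negligible_subset by blast
    moreover have "negligible A" if "A \<in> sets torus_measure" "measure torus_measure A = 0"
      for A :: "(real ^ 'd) set"
    proof -
      have "A \<in> null_sets torus_measure"
        using that by (intro null_setsI) (simp_all add: torus.emeasure_eq_measure)
      then show ?thesis
        by (simp add: negligible_iff_null_sets torus_measure_def null_sets_restrict_space sets_torus_cell)
    qed
    ultimately have "measure torus_measure {z \<in> space torus_measure. m - e < q z} \<noteq> 0"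
      using sets by blast
    then show ?thesis by (simp add: zero_less_measure_iff)
  qed
  note ppos = torus.integral_power_pos[OF mq q0 qm m pos]
  define K where "K n z = 1 / (\<integral>x. q x ^ n \<partial>torus_measure) * q z ^ n" for n z
  show ?thesis
  proof (rule that)
    fix n
    show "prob_kernel (K n)"
      unfolding prob_kernel_def
    proof (intro conjI allI)
      show "cosine_poly (K n)"
        unfolding K_def by (intro cosine_poly.scale cosine_poly_power cq)
      show "0 \<le> K n z" for z
        using ppos[of n] q0[of z] by (simp add: K_def)
      show "(\<integral>z. K n z \<partial>torus_measure) = 1"
        using ppos[of n] by (simp add: K_def)
    qed
  next
    have "(\<integral>z. torus_dist z * K n z \<partial>torus_measure)
        = (\<integral>z. (m - q z) * q z ^ n \<partial>torus_measure) / (\<integral>z. q z ^ n \<partial>torus_measure)" for n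
    proof -
      have "torus_dist z * K n z = 1 / (\<integral>x. q x ^ n \<partial>torus_measure) * ((m - q z) * q z ^ n)" for z
        by (simp add: K_def q_def)
      then show ?thesis by simp
    qed
    then show "(\<lambda>n. \<integral>z. torus_dist z * K n z \<partial>torus_measure) \<longlonglongrightarrow> 0"
      using torus.integral_power_concentration[OF mq q0 qm m pos] by simp
  qed
qed

section \<open>Green's identity in the first-order Sobolev space\<close>

lemma kernel_energy_nonneg: "prob_kernel K \<Longrightarrow> 0 \<le> kernel_energy K f"
  unfolding kernel_energy_def prob_kernel_def by (intro integral_nonneg_AE AE_I2) auto

lemma kernel_energy_tendsto_0:
  fixes K :: "nat \<Rightarrow> real ^ 'd \<Rightarrow> real"
  assumes K: "\<And>n. prob_kernel (K n)"
    and conc: "(\<lambda>n. \<integral>z. torus_dist z * K n z \<partial>torus_measure) \<longlonglongrightarrow> 0"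
    and f: "square_integrable torus_measure f"
  shows "(\<lambda>n. kernel_energy (K n) f) \<longlonglongrightarrow> 0"
proof (rule order_tendstoI)
  fix a :: real assume "a < 0"
  then show "\<forall>\<^sub>F n in sequentially. a < kernel_energy (K n) f"
    using kernel_energy_nonneg[OF K] by (intro always_eventually allI) (blast intro: less_le_trans)
next
  fix a :: real assume a: "0 < a"
  define V where "V = measure torus_measure (space (torus_measure :: (real ^ 'd) measure))"
  have V: "0 \<le> V" by (simp add: V_def)
  obtain p where cp: "continuous_on UNIV p" and p0: "\<And>x. x \<notin> interior torus_cell \<Longrightarrow> p x = 0"
    and close: "(\<integral>x. (f x - p x)\<^sup>2 \<partial>torus_measure) < a / 12"
    using continuous_dense_L2[OF f, of "a / 12"] a by auto
  \<comment> \<open>The constants make the two errors at most half and a quarter of \<open>a\<close>; adding one keeps the denominator positive.\<close>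
  define e where "e = a / (12 * (V + 1))"
  have e: "0 < e" using a V by (simp add: e_def)
  have eV: "3 * (e * V) \<le> a / 4"
    using a V by (simp add: e_def field_simps)
  obtain C where C: "0 \<le> C" and bound: "\<And>x y. x \<in> torus_cell \<Longrightarrow> y \<in> torus_cell \<Longrightarrow>
    (p x - p y)\<^sup>2 \<le> e + C * torus_dist (x - y)"
    using continuous_diff_le_torus_dist[OF cp p0 e] by blast
  note ps = square_integrable_continuous[OF cp]
  have en: "kernel_energy (K n) p \<le> e * V + C * V * (\<integral>z. torus_dist z * K n z \<partial>torus_measure)" for n
  proof -
    have cK: "cosine_poly (K n)" and K0: "\<And>z. 0 \<le> K n z" and K1: "(\<integral>z. K n z \<partial>torus_measure) = 1"
      using K[of n] by (auto simp: prob_kernel_def)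
    note cT = cosine_poly_mult[OF cosine_poly_torus_dist cK]
    have one: "integrable torus_measure (\<lambda>x :: real ^ 'd. c :: real)" for c
      by (rule torus.integrable_const)
    have "kernel_energy (K n) p \<le> (\<integral>z. e * K n (fst z - snd z)
        + C * (torus_dist (fst z - snd z) * K n (fst z - snd z)) \<partial>(torus_measure \<Otimes>\<^sub>M torus_measure))"
      unfolding kernel_energy_def
    proof (rule integral_mono)
      fix z :: "(real ^ 'd) \<times> (real ^ 'd)"
      assume "z \<in> space (torus_measure \<Otimes>\<^sub>M torus_measure)"
      then have "fst z \<in> torus_cell" "snd z \<in> torus_cell" by (auto simp: space_pair_measure)
      then show "(p (fst z) - p (snd z))\<^sup>2 * K n (fst z - snd z)
          \<le> e * K n (fst z - snd z) + C * (torus_dist (fst z - snd z) * K n (fst z - snd z))"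
        using mult_right_mono[OF bound K0[of "fst z - snd z"], of "fst z" "snd z"]
        by (simp add: algebra_simps)
    qed (use kernel_energy_integrable[OF ps cK] kernel_integrable_fst[OF one cK, of 1]
        kernel_integrable_fst[OF one cT, of 1] in auto)
    also have "\<dots> = e * V + C * V * (\<integral>z. torus_dist z * K n z \<partial>torus_measure)"
      using kernel_integral_fst[OF one cK, of 1] kernel_integral_fst[OF one cT, of 1]
        kernel_integrable_fst[OF one cK, of 1] kernel_integrable_fst[OF one cT, of 1] K1
      by (simp add: V_def)
    finally show ?thesis .
  qed
  have "(\<lambda>n. a / 2 + a / 4 + 3 * (C * V * (\<integral>z. torus_dist z * K n z \<partial>torus_measure)))
      \<longlonglongrightarrow> a / 2 + a / 4 + 3 * (C * V * 0)"
    by (intro tendsto_intros conc)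
  then have "\<forall>\<^sub>F n in sequentially.
      a / 2 + a / 4 + 3 * (C * V * (\<integral>z. torus_dist z * K n z \<partial>torus_measure)) < a"
    by (rule order_tendstoD) (use a in auto)
  then show "\<forall>\<^sub>F n in sequentially. kernel_energy (K n) f < a"
  proof eventually_elim
    case (elim n)
    then show ?case
      using kernel_energy_approx[OF f ps K, of n] close en[of n] eV by linarith
  qed
qed

lemma kernel_form_tendsto:
  fixes K :: "nat \<Rightarrow> real ^ 'd \<Rightarrow> real"
  assumes K: "\<And>n. prob_kernel (K n)"
    and conc: "(\<lambda>n. \<integral>z. torus_dist z * K n z \<partial>torus_measure) \<longlonglongrightarrow> 0"
    and f: "square_integrable torus_measure f" and h: "square_integrable torus_measure h"
  shows "(\<lambda>n. kernel_form (K n) f h) \<longlonglongrightarrow> (\<integral>x. f x * h x \<partial>torus_measure)"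
proof (rule Lim_null[THEN iffD2], rule Lim_null_comparison)
  show "\<forall>\<^sub>F n in sequentially. norm (kernel_form (K n) f h - (\<integral>x. f x * h x \<partial>torus_measure))
      \<le> (kernel_energy (K n) f + kernel_energy (K n) h) / 4"
    using kernel_form_error[OF f h K] by (simp add: abs_minus_commute)
  have "(\<lambda>n. (kernel_energy (K n) f + kernel_energy (K n) h) / 4) \<longlonglongrightarrow> (0 + 0) / 4"
    by (intro tendsto_intros kernel_energy_tendsto_0 K conc f h) simp
  then show "(\<lambda>n. (kernel_energy (K n) f + kernel_energy (K n) h) / 4) \<longlonglongrightarrow> 0"
    by simp
qed

text \<open>Functions that are merely in \<open>H\<^sup>1\<close> are admissible as test functions: the identity holds for every
mollifying kernel, and all the forms converge along an approximate identity.\<close>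

proposition weak_Green_identity:
  fixes w v :: "real ^ 'd \<Rightarrow> real"
  assumes g: "torus_L2 g" "is_weak_laplacian w g"
    and G: "torus_L2 G" "is_weak_gradient w G"
    and v: "torus_L2 v" and H: "torus_L2 H" "is_weak_gradient v H"
  shows "(\<integral>x. g x * v x \<partial>torus_measure) = - (\<Sum>i\<in>UNIV. \<integral>x. G x $ i * H x $ i \<partial>torus_measure)"
proof -
  obtain K :: "nat \<Rightarrow> real ^ 'd \<Rightarrow> real" where K: "\<And>n. prob_kernel (K n)"
    and conc: "(\<lambda>n. \<integral>z. torus_dist z * K n z \<partial>torus_measure) \<longlonglongrightarrow> 0"
    using approximate_identity_exists by blast
  note lim = kernel_form_tendsto[OF K conc]
  have "(\<lambda>n. - (\<Sum>i\<in>UNIV. kernel_form (K n) (\<lambda>x. G x $ i) (\<lambda>x. H x $ i)))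
      \<longlonglongrightarrow> - (\<Sum>i\<in>UNIV. \<integral>x. G x $ i * H x $ i \<partial>torus_measure)"
    by (intro tendsto_minus tendsto_sum lim torus_L2_component G H)
  moreover have "kernel_form (K n) g v
      = - (\<Sum>i\<in>UNIV. kernel_form (K n) (\<lambda>x. G x $ i) (\<lambda>x. H x $ i))" for n
    using K[of n] by (intro kernel_form_Green[OF g G v H]) (simp add: prob_kernel_def)
  moreover have "(\<lambda>n. kernel_form (K n) g v) \<longlonglongrightarrow> (\<integral>x. g x * v x \<partial>torus_measure)"
    by (intro lim torus_L2_square_integrable g v)
  ultimately show ?thesis
    by (simp add: LIMSEQ_unique)
qed

section \<open>Decay of the energy\<close>

text \<open>The function \<open>x\<^sup>2 / 2 - cos x\<close> is convex, so it lies above its tangents.\<close>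

lemma cos_le_quadratic: "cos b \<le> cos a - sin a * (b - a) + (b - a)\<^sup>2 / 2" for a b :: real
proof -
  have "convex_on UNIV (\<lambda>x :: real. x\<^sup>2 / 2 - cos x)"
  proof (rule f''_ge0_imp_convex)
    show "((\<lambda>x. x\<^sup>2 / 2 - cos x) has_real_derivative x + sin x) (at x)" for x :: real
      by (auto intro!: derivative_eq_intros)
    show "((\<lambda>x. x + sin x) has_real_derivative 1 + cos x) (at x)" for x :: real
      by (auto intro!: derivative_eq_intros)
    show "0 \<le> 1 + cos x" for x :: real
      using cos_ge_minus_one[of x] by linarith
  qed simp
  moreover have "((\<lambda>x. x\<^sup>2 / 2 - cos x) has_real_derivative a + sin a) (at a within UNIV)"
    by (auto intro!: derivative_eq_intros)
  ultimately have "(b\<^sup>2 / 2 - cos b) - (a\<^sup>2 / 2 - cos a) \<ge> (a + sin a) * (b - a)"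
    by (intro convex_on_imp_above_tangent[where A = UNIV]) auto
  moreover have "(b - a)\<^sup>2 / 2 = b\<^sup>2 / 2 - a\<^sup>2 / 2 - a * (b - a)"
    by (simp add: power2_eq_square field_simps)
  ultimately show ?thesis
    unfolding distrib_right by linarith
qed

lemma weak_gradient_torus_H1:
  assumes "torus_H1 u"
  shows "torus_L2 (weak_gradient u)" and "is_weak_gradient u (weak_gradient u)"
proof -
  obtain G where "torus_L2 G \<and> is_weak_gradient u G"
    using assms by (auto simp: torus_H1_def)
  then have "torus_L2 (weak_gradient u) \<and> is_weak_gradient u (weak_gradient u)"
    unfolding weak_gradient_def by (rule someI[where P = "\<lambda>G. torus_L2 G \<and> is_weak_gradient u G"])
  then show "torus_L2 (weak_gradient u)" and "is_weak_gradient u (weak_gradient u)"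
    by auto
qed

lemma L2_torus_norm_squared:
  assumes "torus_L2 G"
  shows "(L2_torus_norm G)\<^sup>2 = (\<Sum>i\<in>UNIV. \<integral>x. G x $ i * G x $ i \<partial>torus_measure)"
proof -
  have "(L2_torus_norm G)\<^sup>2 = (\<integral>x. (norm (G x))\<^sup>2 \<partial>torus_measure)"
    unfolding L2_torus_norm_def by (intro real_sqrt_pow2 integral_nonneg_AE AE_I2) simp
  also have "\<dots> = (\<integral>x. (\<Sum>i\<in>UNIV. G x $ i * G x $ i) \<partial>torus_measure)"
    by (simp add: power2_norm_eq_inner inner_vec_def)
  also have "\<dots> = (\<Sum>i\<in>UNIV. \<integral>x. G x $ i * G x $ i \<partial>torus_measure)"
    by (intro Bochner_Integration.integral_sum square_integrable_mult torus_L2_component assms)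
  finally show ?thesis .
qed

text \<open>Testing the equation with the increment \<open>w - u\<close>. The implicit diffusion controls the gradient
energy, and the explicit reaction controls the potential up to half the squared norm of the
increment, which the difference quotient absorbs when \<open>1 / 2 \<le> 1 / \<tau>\<close>.\<close>

proposition imex_step_energy_le:
  fixes u w :: "real ^ 'd \<Rightarrow> real"
  assumes \<tau>: "0 < \<tau>" "\<tau> \<le> 2" and u: "torus_H1 u" and step: "imex_step \<kappa> \<tau> u w"
  shows "energy \<kappa> w \<le> energy \<kappa> u"
proof -
  have w: "torus_H1 w" using step by (simp add: imex_step_def)
  obtain g where g: "torus_L2 g" "is_weak_laplacian w g"
    and eq: "AE x in torus_measure. (w x - u x) / \<tau> = \<kappa>\<^sup>2 * g x + sin (u x)"
    using step by (auto simp: imex_step_def)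
  define G where "G = weak_gradient w"
  define H where "H = weak_gradient u"
  note G = weak_gradient_torus_H1[OF w, folded G_def]
  note H = weak_gradient_torus_H1[OF u, folded H_def]
  have L2: "torus_L2 u" "torus_L2 w" using u w by (auto simp: torus_H1_def)
  note us = torus_L2_square_integrable[OF L2(1)] and ws = torus_L2_square_integrable[OF L2(2)]
    and gs = torus_L2_square_integrable[OF g(1)]
  note um = us[unfolded square_integrable_def, THEN conjunct1]
    and wm = ws[unfolded square_integrable_def, THEN conjunct1]
  have vs: "square_integrable torus_measure (\<lambda>x. w x - u x)"
    by (rule square_integrable_diff[OF ws us])
  then have v2: "integrable torus_measure (\<lambda>x. (w x - u x)\<^sup>2)"
    by (simp add: square_integrable_def)
  have "square_integrable torus_measure (\<lambda>x. sin (u x))"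
    by (rule square_integrable_bounded[OF finite_measure_torus, where C = 1]) (use um in auto)
  then have sv: "integrable torus_measure (\<lambda>x. sin (u x) * (w x - u x))"
    by (rule square_integrable_mult) (rule vs)
  have cos_int: "integrable torus_measure (\<lambda>x. cos (u x))" "integrable torus_measure (\<lambda>x. cos (w x))"
    by (intro square_integrable_imp_integrable[OF finite_measure_torus]
        square_integrable_bounded[OF finite_measure_torus, where C = 1]; use um wm in auto)+
  note gw = square_integrable_mult[OF gs ws] and gu = square_integrable_mult[OF gs us]
  note GG = square_integrable_mult[OF torus_L2_component[OF G(1)] torus_L2_component[OF G(1)]]
    and HH = square_integrable_mult[OF torus_L2_component[OF H(1)] torus_L2_component[OF H(1)]]
    and GH = square_integrable_mult[OF torus_L2_component[OF G(1)] torus_L2_component[OF H(1)]]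

  have gradient: "(L2_torus_norm G)\<^sup>2 / 2 - (L2_torus_norm H)\<^sup>2 / 2
      \<le> - (\<integral>x. g x * (w x - u x) \<partial>torus_measure)"
  proof -
    have "(\<integral>x. G x $ i * G x $ i \<partial>torus_measure) / 2 - (\<integral>x. H x $ i * H x $ i \<partial>torus_measure) / 2
        \<le> (\<integral>x. G x $ i * G x $ i \<partial>torus_measure) - (\<integral>x. G x $ i * H x $ i \<partial>torus_measure)" for i
    proof -
      have "(\<integral>x. G x $ i * G x $ i / 2 - H x $ i * H x $ i / 2 \<partial>torus_measure)
          \<le> (\<integral>x. G x $ i * G x $ i - G x $ i * H x $ i \<partial>torus_measure)"
      proof (rule integral_mono)
        fix x
        show "G x $ i * G x $ i / 2 - H x $ i * H x $ i / 2 \<le> G x $ i * G x $ i - G x $ i * H x $ i"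
          using sum_squares_bound[of "G x $ i" "H x $ i"] by (simp add: power2_eq_square)
      qed (use GG[of i i] HH[of i i] GH[of i i] in auto)
      then show ?thesis using GG[of i i] HH[of i i] GH[of i i] by simp
    qed
    then have "(\<Sum>i\<in>UNIV. (\<integral>x. G x $ i * G x $ i \<partial>torus_measure) / 2
          - (\<integral>x. H x $ i * H x $ i \<partial>torus_measure) / 2)
        \<le> (\<Sum>i\<in>UNIV. (\<integral>x. G x $ i * G x $ i \<partial>torus_measure) - (\<integral>x. G x $ i * H x $ i \<partial>torus_measure))"
      by (intro sum_mono)
    moreover have "(\<integral>x. g x * (w x - u x) \<partial>torus_measure)
        = (\<integral>x. g x * w x \<partial>torus_measure) - (\<integral>x. g x * u x \<partial>torus_measure)"
      using gw gu by (simp add: right_diff_distrib)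
    ultimately show ?thesis
      unfolding L2_torus_norm_squared[OF G(1)] L2_torus_norm_squared[OF H(1)]
        weak_Green_identity[OF g G L2(2) G] weak_Green_identity[OF g G L2(1) H]
      by (simp add: sum_subtractf sum_divide_distrib)
  qed
  have reaction: "\<kappa>\<^sup>2 * (\<integral>x. g x * (w x - u x) \<partial>torus_measure)
      = (\<integral>x. (w x - u x)\<^sup>2 \<partial>torus_measure) / \<tau> - (\<integral>x. sin (u x) * (w x - u x) \<partial>torus_measure)"
  proof -
    have "\<kappa>\<^sup>2 * (\<integral>x. g x * (w x - u x) \<partial>torus_measure)
        = (\<integral>x. \<kappa>\<^sup>2 * (g x * (w x - u x)) \<partial>torus_measure)"
      by simp
    also have "\<dots> = (\<integral>x. (w x - u x)\<^sup>2 / \<tau> - sin (u x) * (w x - u x) \<partial>torus_measure)"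
    proof (rule integral_cong_AE)
      show "AE x in torus_measure.
          \<kappa>\<^sup>2 * (g x * (w x - u x)) = (w x - u x)\<^sup>2 / \<tau> - sin (u x) * (w x - u x)"
        using eq
      proof eventually_elim
        case (elim x)
        then have "\<kappa>\<^sup>2 * g x = (w x - u x) / \<tau> - sin (u x)" by linarith
        then have "\<kappa>\<^sup>2 * g x * (w x - u x) = ((w x - u x) / \<tau> - sin (u x)) * (w x - u x)" by simp
        then show ?case by (simp add: power2_eq_square left_diff_distrib mult.assoc)
      qed
    qed (use square_integrable_mult[OF gs vs] v2 sv in \<open>auto intro!: borel_measurable_integrable\<close>)
    also have "\<dots> = (\<integral>x. (w x - u x)\<^sup>2 \<partial>torus_measure) / \<tau>
        - (\<integral>x. sin (u x) * (w x - u x) \<partial>torus_measure)"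
      using v2 sv by simp
    finally show ?thesis .
  qed
  have potential: "(\<integral>x. cos (w x) \<partial>torus_measure) - (\<integral>x. cos (u x) \<partial>torus_measure)
      \<le> (\<integral>x. (w x - u x)\<^sup>2 \<partial>torus_measure) / 2 - (\<integral>x. sin (u x) * (w x - u x) \<partial>torus_measure)"
  proof -
    have "(\<integral>x. cos (w x) - cos (u x) \<partial>torus_measure)
        \<le> (\<integral>x. (w x - u x)\<^sup>2 / 2 - sin (u x) * (w x - u x) \<partial>torus_measure)"
    proof (rule integral_mono)
      fix x
      show "cos (w x) - cos (u x) \<le> (w x - u x)\<^sup>2 / 2 - sin (u x) * (w x - u x)"
        using cos_le_quadratic[of "w x" "u x"] by simp
    qed (use v2 sv cos_int in auto)
    then show ?thesis using v2 sv cos_int by simp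
  qed
  have "0 \<le> (\<integral>x. (w x - u x)\<^sup>2 \<partial>torus_measure)"
    by (intro integral_nonneg_AE AE_I2) simp
  then have damping: "(\<integral>x. (w x - u x)\<^sup>2 \<partial>torus_measure) / 2 \<le> (\<integral>x. (w x - u x)\<^sup>2 \<partial>torus_measure) / \<tau>"
    using \<tau> by (intro divide_left_mono) auto
  have "\<kappa>\<^sup>2 / 2 * (L2_torus_norm G)\<^sup>2 - \<kappa>\<^sup>2 / 2 * (L2_torus_norm H)\<^sup>2
      \<le> - (\<kappa>\<^sup>2 * (\<integral>x. g x * (w x - u x) \<partial>torus_measure))"
    using mult_left_mono[OF gradient, of "\<kappa>\<^sup>2"] by (simp add: right_diff_distrib)
  then show ?thesis
    using reaction potential damping unfolding energy_def G_def[symmetric] H_def[symmetric]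
    by linarith
qed

theorem theorem4p2:
  fixes \<kappa> \<tau> :: real and u :: "nat \<Rightarrow> real ^ 'd \<Rightarrow> real"
  assumes "\<kappa> > 0" and "0 < \<tau>" and "\<tau> \<le> 2"
    and "torus_H1 (u 0)"
    and "\<And>n. imex_step \<kappa> \<tau> (u n) (u (Suc n))"
  shows "\<forall>n. energy \<kappa> (u (Suc n)) \<le> energy \<kappa> (u n)"
proof
  fix n
  have "torus_H1 (u n)"
    using assms(4,5) by (cases n) (auto simp: imex_step_def)
  then show "energy \<kappa> (u (Suc n)) \<le> energy \<kappa> (u n)"
    using assms by (intro imex_step_energy_le)
qed

end
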